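(* For $a>1$ let $0<s_{1}<s_{2}<s_{3}<\cdots$ denote the positive zeros $\theta=s_m=s_m(a)$ of $\theta\mapsto\mathrm{Si}(a,a\theta)$, and for $m=1,2,3,\ldots$ let $s_{m,0}=s_{m,0}(a)$ be the positive root of $$a s_{m,0}-\arctan(s_{m,0})=m\pi .$$ Then $$s_{m}\sim s_{m,0}+\sum_{k=2}^{\infty}\frac{q_{k}(s_{m,0})}{a^{k}}\qquad(a\to+\infty)$$ uniformly for $m=1,2,3,\ldots$; that is, for every integer $N\ge1$, $s_m-s_{m,0}-\sum_{k=2}^{N}q_k(s_{m,0})a^{-k}=\mathcal{O}(a^{-N-1})$ as $a\to+\infty$, uniformly in $m\ge1$, where $q_k(x)$ are the rational functions defined in the context.
   Context: $\mathrm{Si}(a,z)=\int_0^z t^{a-1}\sin t\,dt$ for $a>0$. Coefficients: $F^{-}_{0}(z)=-\dfrac{z}{(z-1)^{2}}$, $F^{-}_{1}(z)=-\dfrac{2z(z+1)}{(z-1)^{4}}$, and for $s=1,2,3,\ldots$ $$F^{-}_{s+1}(z)=\frac{z}{1-z}\frac{dF^{-}_{s}(z)}{dz}-\frac12\sum_{j=0}^{s}F^{-}_{j}(z)F^{-}_{s-j}(z).$$ For $s\ge1$, $E^{-}_{s}$ is the rational function with $E^{-}_{s}(0)=0$ given by $E^{-}_{s}(z)=\int_{0}^{z}\frac{(t-1)F^{-}_{s}(t)}{2t}\,dt$ (e.g. $E^{-}_{1}(z)=\frac{z}{(z-1)^{2}}$, $E^{-}_{2}(z)=\frac{z(3z+2)}{2(z-1)^{4}}$).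 For real $\theta$ put $L_{s}(\theta)=(-1)^{s}\Im\{E^{-}_{s}(-i\theta)\}$, a real rational function of $\theta$. The functions $q_k(x)$ ($k=2,3,4,\ldots$) are the unique functions such that, as an identity of formal power series in $1/a$, the substitution $\theta=x+\sum_{k\ge2}q_k(x)a^{-k}$ gives $$a\theta-\arctan(\theta)+\sum_{s=1}^{\infty}\frac{L_s(\theta)}{a^{s}}=ax-\arctan(x)$$ (expand in inverse powers of $a$ and equate like powers). They are rational functions; the first two are $q_{2}(x)=\frac{x(x^2-1)}{(x^2+1)^2}$ and $q_{3}(x)=\frac{4x^3(2x^2-3)}{(x^2+1)^4}$. *)

theory Defs
  imports
    "HOL-Complex_Analysis.Complex_Analysis"
    "HOL-Computational_Algebra.Formal_Laurent_Series"
begin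

definition Si :: "real \<Rightarrow> real \<Rightarrow> real" where
  "Si a z = integral {0..z} (\<lambda>t. t powr (a - 1) * sin t)"

text \<open>The rational functions \<open>F\<^sup>-\<^sub>s\<close>, as functions on the complex plane. Their only
  pole is at 1, where the values below are meaningless.\<close>

fun F_minus :: "nat \<Rightarrow> complex \<Rightarrow> complex" where
  "F_minus 0 = (\<lambda>z. - z / (z - 1)\<^sup>2)"
| "F_minus (Suc 0) = (\<lambda>z. - (2 * z * (z + 1)) / (z - 1) ^ 4)"
| "F_minus (Suc (Suc s)) = (\<lambda>z. z / (1 - z) * deriv (F_minus (Suc s)) z
      - 1 / 2 * (\<Sum>j\<le>Suc s. F_minus j z * F_minus (Suc s - j) z))"

text \<open>The integral is taken along the straight segment, so this is the rational function
  \<open>E\<^sup>-\<^sub>s\<close> away from the ray \<open>[1, \<infinity>)\<close>; only the imaginary axis is used below.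
  The integrand has a removable singularity at 0; its value there does not affect the integral.\<close>

definition E_minus :: "nat \<Rightarrow> complex \<Rightarrow> complex" where
  "E_minus s z = contour_integral (linepath 0 z) (\<lambda>t. (t - 1) * F_minus s t / (2 * t))"

definition L_coeff :: "nat \<Rightarrow> real \<Rightarrow> real" where
  "L_coeff s \<theta> = (-1) ^ s * Im (E_minus s (- \<i> * complex_of_real \<theta>))"

definition taylor_fps :: "(real \<Rightarrow> real) \<Rightarrow> real \<Rightarrow> real fps" where
  "taylor_fps f x = Abs_fps (\<lambda>n. (deriv ^^ n) f x / fact n)"

text \<open>The formal variable \<open>X\<close> stands for \<open>1 / a\<close>, hence \<open>fls_X_inv\<close> for \<open>a\<close>, and \<open>Q\<close> for
  \<open>\<theta> - x = (\<Sum>k\<ge>2. q\<^sub>k(x) / a ^ k)\<close>. Substituting \<open>\<theta>\<close> into a smooth function \<open>f\<close> is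
  composition of the Taylor series of \<open>f\<close> at \<open>x\<close> with \<open>Q\<close>. The infinite sum converges in the
  \<open>X\<close>-adic topology of formal power series.\<close>

definition formal_identity :: "real \<Rightarrow> real fps \<Rightarrow> bool" where
  "formal_identity x Q \<longleftrightarrow>
     fls_X_inv * fps_to_fls (fps_const x + Q)
       + fps_to_fls (- (taylor_fps arctan x oo Q)
           + (\<Sum>s. fps_X ^ Suc s * (taylor_fps (L_coeff (Suc s)) x oo Q)))
     = fls_X_inv * fls_const x - fls_const (arctan x)"

definition q_coeff :: "nat \<Rightarrow> real \<Rightarrow> real" where
  "q_coeff k x = fps_nth (THE Q. fps_nth Q 0 = 0 \<and> fps_nth Q 1 = 0 \<and> formal_identity x Q) k"

text \<open>The \<open>m\<close>-th positive zero in increasing order (\<open>m \<ge> 1\<close>): the one for which there are exactly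
  \<open>m\<close> zeros in \<open>(0, \<theta>]\<close>.\<close>

definition Si_zero :: "nat \<Rightarrow> real \<Rightarrow> real" where
  "Si_zero m a = (THE \<theta>. 0 < \<theta> \<and> Si a (a * \<theta>) = 0 \<and>
     card {t. 0 < t \<and> t \<le> \<theta> \<and> Si a (a * t) = 0} = m)"

definition Si_zero0 :: "nat \<Rightarrow> real \<Rightarrow> real" where
  "Si_zero0 m a = (THE x. 0 < x \<and> a * x - arctan x = real m * pi)"

text \<open>The definite description of \<open>q_coeff\<close> is well defined.\<close>

lemma fps_nth_suminf_X_power:
  fixes G :: "nat \<Rightarrow> real fps"
  shows "fps_nth (\<Sum>s. fps_X ^ Suc s * G s) n = (\<Sum>s<n. fps_nth (G s) (n - Suc s))"
proof -
  define T where "T = Abs_fps (\<lambda>n. \<Sum>s<n. fps_nth (G s) (n - Suc s))"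
  have nth: "fps_nth (\<Sum>s<k. fps_X ^ Suc s * G s) n = fps_nth T n" if "n \<le> k" for k n
  proof -
    have "fps_nth (\<Sum>s<k. fps_X ^ Suc s * G s) n
        = (\<Sum>s<k. if n < Suc s then 0 else fps_nth (G s) (n - Suc s))"
      by (simp only: fps_sum_nth fps_X_power_mult_nth)
    also have "\<dots> = (\<Sum>s<n. fps_nth (G s) (n - Suc s))"
      using that by (intro sum.mono_neutral_cong_right) auto
    finally show ?thesis by (simp add: T_def)
  qed
  have "(\<lambda>s. fps_X ^ Suc s * G s) sums T"
    unfolding sums_def
    by (intro tendsto_fpsI) (use nth in \<open>auto simp: eventually_at_top_linorder\<close>)
  then have "(\<Sum>s. fps_X ^ Suc s * G s) = T"
    by (rule sums_unique[symmetric])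
  then show ?thesis by (simp add: T_def)
qed

definition q_step :: "real \<Rightarrow> nat \<Rightarrow> real fps \<Rightarrow> real" where
  "q_step x n Q = fps_nth (taylor_fps arctan x oo Q) n - (if n = 0 then arctan x else 0)
     - (\<Sum>s<n. fps_nth (taylor_fps (L_coeff (Suc s)) x oo Q) (n - Suc s))"

lemma formal_identity_iff:
  assumes "fps_nth Q 0 = 0"
  shows "formal_identity x Q \<longleftrightarrow> (\<forall>n. fps_nth Q (Suc n) = q_step x n Q)"
proof -
  define S where "S = (\<Sum>s. fps_X ^ Suc s * (taylor_fps (L_coeff (Suc s)) x oo Q))"
  have fls: "fls_X_inv * fps_to_fls Q = fps_to_fls (fps_shift 1 Q)"
  proof (rule fls_eqI)
    fix n :: int
    show "fls_nth (fls_X_inv * fps_to_fls Q) n = fls_nth (fps_to_fls (fps_shift 1 Q)) n"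
    proof (cases "n < 0")
      case True
      then show ?thesis
        using assms by (cases "n = -1") (auto simp: fls_X_inv_times_conv_shift)
    qed (simp add: fls_X_inv_times_conv_shift nat_add_distrib)
  qed
  have "formal_identity x Q \<longleftrightarrow>
     fps_to_fls (fps_shift 1 Q - (taylor_fps arctan x oo Q) + S)
      = fps_to_fls (- fps_const (arctan x))"
    unfolding formal_identity_def fps_to_fls_plus fps_to_fls_minus fps_to_fls_uminus
      distrib_left fls fps_const_to_fls S_def[symmetric]
    by (simp only: add.assoc add_left_cancel diff_conv_add_uminus)
  also have "\<dots> \<longleftrightarrow> (\<forall>n. fps_nth Q (Suc n) = q_step x n Q)"
    unfolding fps_to_fls_eq_iff fps_eq_iff
    by (intro all_cong1)
      (simp add: q_step_def S_def fps_nth_suminf_X_power del: power_Suc; linarith)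
  finally show ?thesis .
qed

lemma fps_power_nth_cong:
  fixes P Q :: "real fps"
  assumes "\<And>i. i \<le> n \<Longrightarrow> fps_nth P i = fps_nth Q i"
  shows "fps_nth (P ^ k) n = fps_nth (Q ^ k) n"
  using assms
proof (induction k arbitrary: n)
  case (Suc k)
  then show ?case by (auto simp: fps_mult_nth intro!: sum.cong)
qed simp

lemma q_step_cong:
  assumes "\<And>i. i \<le> n \<Longrightarrow> fps_nth P i = fps_nth Q i"
  shows "q_step x n P = q_step x n Q"
proof -
  have "fps_nth (f oo P) m = fps_nth (f oo Q) m" if "m \<le> n" for f m
    unfolding fps_compose_nth
    using assms that by (intro sum.cong refl arg_cong2[of _ _ _ _ "(*)"] fps_power_nth_cong) auto
  then show ?thesis unfolding q_step_def by simp
qed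

primrec q_partial :: "real \<Rightarrow> nat \<Rightarrow> real fps" where
  "q_partial x 0 = 0"
| "q_partial x (Suc n) = q_partial x n + fps_const (q_step x n (q_partial x n)) * fps_X ^ Suc n"

lemma q_coeff_well_defined:
  "\<exists>!Q. fps_nth Q 0 = 0 \<and> fps_nth Q 1 = 0 \<and> formal_identity x Q"
proof (rule ex_ex1I)
  define Q where "Q = Abs_fps (\<lambda>n. fps_nth (q_partial x n) n)"
  have partial: "fps_nth (q_partial x n) i = fps_nth Q i" if "i \<le> n" for n i
    using that
  proof (induction n)
    case (Suc n)
    then show ?case
      by (cases "i = Suc n") (auto simp: Q_def fps_X_power_mult_right_nth simp del: power_Suc)
  qed (simp add: Q_def)
  have top: "fps_nth (q_partial x n) (Suc n) = 0" for n
  proof -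
    have "fps_nth (q_partial x n) j = 0" if "n < j" for j
      using that by (induction n) (auto simp: fps_X_power_mult_right_nth simp del: power_Suc)
    then show ?thesis by simp
  qed
  have "fps_nth Q (Suc n) = q_step x n (q_partial x n)" for n
    using top[of n] by (simp add: Q_def fps_X_power_mult_right_nth del: power_Suc)
  moreover have "q_step x n (q_partial x n) = q_step x n Q" for n
    using partial by (intro q_step_cong)
  ultimately have rec: "fps_nth Q (Suc n) = q_step x n Q" for n
    by simp
  have "fps_nth Q 0 = 0" by (simp add: Q_def)
  moreover have "fps_nth Q 1 = 0"
    using rec[of 0] by (simp add: q_step_def taylor_fps_def)
  ultimately show "\<exists>Q. fps_nth Q 0 = 0 \<and> fps_nth Q 1 = 0 \<and> formal_identity x Q"
    using rec formal_identity_iff by blast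
next
  fix P Q
  assume P: "fps_nth P 0 = 0 \<and> fps_nth P 1 = 0 \<and> formal_identity x P"
    and Q: "fps_nth Q 0 = 0 \<and> fps_nth Q 1 = 0 \<and> formal_identity x Q"
  have "fps_nth P n = fps_nth Q n" for n
  proof (induction n rule: less_induct)
    case (less n)
    show ?case
    proof (cases n)
      case (Suc m)
      then have "q_step x m P = q_step x m Q"
        using less by (intro q_step_cong) auto
      then show ?thesis
        using P Q Suc formal_identity_iff by metis
    qed (use P Q in simp)
  qed
  then show "P = Q" by (simp add: fps_eq_iff)
qed

end

theory Submission
  imports Defs
begin

text \<open>
  Put \<open>H(\<theta>) = \<integral> u powr (a - 1) * cis u\<close> over \<open>[0, a * \<theta>]\<close>, so that \<open>Im H(\<theta>) = Si a (a * \<theta>)\<close>, and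
  \<open>r = 1 / (1 + \<i> * \<theta>)\<close>. To leading order \<open>H\<close> is \<open>M(\<theta>) = cis (a * \<theta>) * (a * \<theta>) powr a / a * r\<close>, whose
  argument is \<open>a * \<theta> - arctan \<theta>\<close>. The ratio \<open>J = H / M\<close> tends to 1 as \<open>a\<close> grows, hence
  \<open>phase = a * \<theta> - arctan \<theta> + Im (Ln J)\<close> is an argument of \<open>H\<close>, the zeros of \<open>Si\<close> are the points where
  the phase is a multiple of \<open>\<pi>\<close>, and since the phase increases from 0, the \<open>m\<close>-th zero is the
  point where it equals \<open>m * \<pi>\<close> (\<open>Si_zero_properties\<close>). The letters \<open>H\<close>, \<open>M\<close>, \<open>J\<close> and, below, \<open>A\<close> stand for
  \<open>Si_complex\<close>, \<open>leading_term\<close>, \<open>amplitude\<close> and \<open>inv_amplitude\<close>; \<open>r\<close> as a function of \<open>\<theta>\<close> is \<open>rr\<close>.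

  In the variable \<open>r = 1 / (1 - z)\<close>, \<open>z = - \<i> * \<theta>\<close>, every \<open>F\<^sub>s\<close> is a polynomial, and so is every \<open>E\<^sub>s\<close> with \<open>s \<ge> 1\<close>.
  As \<open>\<bar>r\<bar> \<le> 1\<close> for real \<open>\<theta>\<close>, this makes all estimates uniform on the whole line. The function \<open>J\<close>
  solves a linear first-order equation. The recursion for \<open>F\<^sub>s\<close> says exactly that the formal
  series \<open>1 - F\<^sub>0 / a - (\<Sum>s\<ge>1. (-1)^s * F\<^sub>s / a^(s+1)) / 2\<close> is the reciprocal of a formal solution,
  so its truncation \<open>A\<close> leaves a residual of high order in \<open>1 / a\<close> that also vanishes at \<open>\<theta> = 0\<close> and
  decays as \<open>r\<^sup>3\<close> (\<open>riccati_residual_bound\<close>). Variation of constants turns this into a uniform bound for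
  \<open>J - 1 / A\<close> (\<open>Si_complex_ratio_approx\<close>). The derivative of the phase is \<open>Im (a / (r * \<theta> * J))\<close>, whereas
  \<open>Im (a * A / (r * \<theta>))\<close> is the derivative of the truncated phase
  \<open>a * \<theta> - arctan \<theta> + (\<Sum>s. L\<^sub>s(\<theta>) / a^s)\<close>. The two differ by \<open>O(a^(-K-1) / (1 + \<theta>\<^sup>2))\<close>, which integrates to
  a uniform bound (\<open>phase_approx\<close>), so no logarithm of a formal series has to be expanded.

  Finally the functions \<open>q\<^sub>k\<close> and all derivatives of \<open>arctan\<close> and \<open>L\<^sub>s\<close> are bounded on the real line. The formal
  identity that defines \<open>q\<^sub>k\<close> is therefore a uniform asymptotic identity, and the truncated phase at
  \<open>x + (\<Sum>k. q\<^sub>k(x) / a^k)\<close>, \<open>x = s\<^sub>m\<^sub>,\<^sub>0\<close>, is \<open>m * \<pi> + O(a^(-N))\<close> (\<open>trunc_phase_at_approximation\<close>).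
  For large \<open>a\<close> the truncated phase has slope at least \<open>3/4 * a\<close>, so this point is within \<open>O(a^(-N-1))\<close> of the zero.
\<close>

section \<open>The coefficients as polynomials in \<open>1 / (1 - z)\<close>\<close>

text \<open>The derivation \<open>z / (1 - z) * d/dz\<close> of the recursion, written in the variable \<open>r = 1 / (1 - z)\<close>: since
  \<open>dr/dz = r\<^sup>2\<close>, it becomes \<open>(r - 1) * r\<^sup>2 * d/dr\<close>, which maps polynomials to polynomials.\<close>

definition Dpoly :: "complex poly \<Rightarrow> complex poly" where
  "Dpoly p = [:0, 0, -1, 1:] * pderiv p"

fun Fpoly :: "nat \<Rightarrow> complex poly" where
  "Fpoly 0 = [:0, 1, -1:]"
| "Fpoly (Suc 0) = smult 2 (Dpoly [:0, 1, -1:])"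
| "Fpoly (Suc (Suc s)) = Dpoly (Fpoly (Suc s))
     - smult (1 / 2) (\<Sum>j\<le>Suc s. Fpoly j * Fpoly (Suc s - j))"

lemma F_minus_eq_poly: "z \<noteq> 1 \<Longrightarrow> F_minus s z = poly (Fpoly s) (1 / (1 - z))"
proof (induction s arbitrary: z rule: F_minus.induct)
  case 1
  then have "1 - z \<noteq> 0" by simp
  moreover have "(z - 1)\<^sup>2 = (1 - z)\<^sup>2" by (simp add: power2_commute)
  ultimately show ?case
    by (simp add: field_simps power2_eq_square)
next
  case 2
  have "F_minus (Suc 0) (1 - u) = poly (Fpoly (Suc 0)) (1 / (1 - (1 - u)))" if "u \<noteq> 0" for u
  proof -
    have "poly (Fpoly (Suc 0)) w = 2 * (w\<^sup>2 * (w - 1)) * (1 - 2 * w)" for w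
      by (simp add: Dpoly_def pderiv_pCons algebra_simps power2_eq_square)
    moreover have "2 * ((1 / u)\<^sup>2 * (1 / u - 1)) * (1 - 2 * (1 / u)) = 2 * (1 - u) * (u - 2) / u ^ 4"
    proof -
      have "1 / u - 1 = (1 - u) / u" "1 - 2 * (1 / u) = (u - 2) / u"
        using that by (simp_all add: field_simps)
      then show ?thesis by (simp add: power4_eq_xxxx power2_eq_square)
    qed
    moreover have "F_minus (Suc 0) (1 - u) = 2 * (1 - u) * (u - 2) / u ^ 4"
    proof -
      have "(1 - u - 1) ^ 4 = u ^ 4" by simp
      moreover have "- (2 * (1 - u) * (1 - u + 1)) = 2 * (1 - u) * (u - 2)"
        by (simp add: algebra_simps)
      ultimately show ?thesis by (simp only: F_minus.simps)
    qed
    moreover have "1 - (1 - u) = u" by simp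
    ultimately show ?thesis by (simp only:)
  qed
  from this[of "1 - z"] 2 show ?case by simp
next
  case (3 s)
  let ?r = "1 / (1 - z)"
  have z: "1 - z \<noteq> 0" using 3 by simp
  have cubic: "(w - 1) * w\<^sup>2 = poly [:0, 0, -1, 1:] w" for w :: complex
    by (simp add: algebra_simps power2_eq_square)
  have d1: "((\<lambda>w. poly (Fpoly (Suc s)) (1 / (1 - w))) has_field_derivative
      poly (pderiv (Fpoly (Suc s))) ?r * ?r\<^sup>2) (at z)"
    using z by (auto intro!: derivative_eq_intros simp: field_simps power2_eq_square)
  have "deriv (F_minus (Suc s)) z = poly (pderiv (Fpoly (Suc s))) ?r * ?r\<^sup>2"
    using d1 3 
    by (intro DERIV_imp_deriv has_field_derivative_transform_within_open[OF d1, of "-{1}"]) auto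
  moreover have "z / (1 - z) = ?r - 1" using z by (simp add: field_simps)
  ultimately have "z / (1 - z) * deriv (F_minus (Suc s)) z
      = ((?r - 1) * ?r\<^sup>2) * poly (pderiv (Fpoly (Suc s))) ?r"
    by (simp only: mult_ac)
  then have "z / (1 - z) * deriv (F_minus (Suc s)) z = poly (Dpoly (Fpoly (Suc s))) ?r"
    unfolding Dpoly_def poly_mult cubic .
  moreover have "F_minus j z = poly (Fpoly j) ?r" if "j \<le> Suc s" for j
    using 3 that by auto
  ultimately show ?case
    unfolding F_minus.simps Fpoly.simps poly_diff poly_smult poly_sum poly_mult by simp
qed

lemma dvd_Dpoly: "[:0, 0, -1, 1:] dvd Dpoly p"
  unfolding Dpoly_def by (rule dvd_triv_left)

text \<open>The factor \<open>(r - 1) * r\<^sup>2\<close> serves two purposes. It cancels the denominator \<open>2 * r\<^sup>2 * (1 - r)\<close> that appears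
  when \<open>E\<^sub>s\<close> is differentiated with respect to \<open>r\<close>, so \<open>E\<^sub>s\<close> is a polynomial in \<open>r\<close>, without a logarithm;
  and it supplies the decay in \<open>\<theta>\<close> of the residual below.\<close>

lemma dvd_Fpoly_Suc: "[:0, 0, -1, 1:] dvd Fpoly (Suc s)"
proof (induction s rule: less_induct)
  case (less s)
  show ?case
  proof (cases s)
    case 0
    then show ?thesis by (simp add: dvd_Dpoly dvd_smult)
  next
    case (Suc n)
    have "[:0, 0, -1, 1:] dvd Fpoly j * Fpoly (Suc n - j)" if "j \<le> Suc n" for j
    proof (cases "j = 0")
      case True
      then show ?thesis
        using less.IH[of n] Suc by (simp only: diff_zero) (rule dvd_mult, simp)
    next
      case False
      then obtain i where "j = Suc i" using not0_implies_Suc by blast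
      then show ?thesis using less.IH[of i] Suc that by (simp add: dvd_mult2)
    qed
    then show ?thesis
      unfolding Suc Fpoly.simps by (intro dvd_diff dvd_Dpoly dvd_smult dvd_sum) simp
  qed
qed

lemma ex_poly_antiderivative:
  fixes p :: "complex poly"
  shows "\<exists>q. pderiv q = p \<and> poly q c = 0"
proof -
  define q where "q = (\<Sum>i\<le>degree p. monom (coeff p i / of_nat (Suc i)) (Suc i))"
  have "pderiv q = p"
  proof (rule poly_eqI)
    fix n
    have "coeff (pderiv q) n = of_nat (Suc n) * (\<Sum>i\<le>degree p. if i = n then coeff p i / of_nat (Suc i) else 0)"
      unfolding coeff_pderiv q_def coeff_sum coeff_monom by simp
    also have "\<dots> = coeff p n"
      by (cases "n \<le> degree p") (auto simp: coeff_eq_0 simp del: of_nat_Suc)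
    finally show "coeff (pderiv q) n = coeff p n" .
  qed
  then show ?thesis
    by (intro exI[of _ "q - [:poly q c:]"]) (simp add: pderiv_diff pderiv_pCons)
qed

definition rr :: "real \<Rightarrow> complex" where
  "rr \<theta> = 1 / (1 + \<i> * of_real \<theta>)"

lemma one_plus_i_nz [simp]: "1 + \<i> * of_real \<theta> \<noteq> 0"
  by (simp add: complex_eq_iff)

lemma rr_nz [simp]: "rr \<theta> \<noteq> 0"
  by (simp add: rr_def)

lemma rr_0 [simp]: "rr 0 = 1"
  by (simp add: rr_def)

lemma i_theta_rr: "\<i> * of_real \<theta> * rr \<theta> = 1 - rr \<theta>"
  by (simp add: rr_def field_simps)

lemma norm_rr_sq: "(norm (rr \<theta>))\<^sup>2 = 1 / (1 + \<theta>\<^sup>2)"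
  by (simp add: rr_def norm_divide power_divide cmod_power2 del: one_plus_i_nz)

lemma norm_rr_le_1: "norm (rr \<theta>) \<le> 1"
proof -
  have "(norm (rr \<theta>))\<^sup>2 \<le> 1\<^sup>2" by (simp add: norm_rr_sq divide_le_eq_1 add_pos_nonneg)
  then show ?thesis by (rule power2_le_imp_le) simp
qed

lemma norm_rr_diff_1: "norm (rr \<theta> - 1) = \<bar>\<theta>\<bar> * norm (rr \<theta>)"
  using arg_cong[OF i_theta_rr[of \<theta>], of norm] by (simp add: norm_mult norm_minus_commute)

lemma Re_rr: "Re (rr \<theta>) = 1 / (1 + \<theta>\<^sup>2)"
  by (simp add: rr_def Re_divide power2_eq_square)

lemma has_vector_derivative_rr:
  "(rr has_vector_derivative - \<i> * (rr \<theta>)\<^sup>2) (at \<theta> within S)"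
proof -
  have "((\<lambda>z. 1 / (1 + \<i> * z)) has_field_derivative - \<i> * (rr \<theta>)\<^sup>2) (at (of_real \<theta>))"
    by (auto intro!: derivative_eq_intros simp: rr_def field_simps power2_eq_square)
  from has_vector_derivative_real_field[OF this] show ?thesis
    by (simp add: o_def rr_def[abs_def] fun_eq_iff)
qed

lemma has_vector_derivative_poly_rr:
  "((\<lambda>\<theta>. poly p (rr \<theta>)) has_vector_derivative - \<i> * (rr \<theta>)\<^sup>2 * poly (pderiv p) (rr \<theta>)) (at \<theta> within S)"
  using field_vector_diff_chain_within[OF has_vector_derivative_rr, OF DERIV_subset[OF poly_DERIV]]
  by (simp add: o_def)

lemma poly_bounded_unit_disc:
  fixes p :: "complex poly"
  shows "\<exists>C\<ge>0. \<forall>r. norm r \<le> 1 \<longrightarrow> norm (poly p r) \<le> C"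
proof (intro exI conjI allI impI)
  show "0 \<le> (\<Sum>i\<le>degree p. norm (coeff p i))" by (simp add: sum_nonneg)
  fix r :: complex assume r: "norm r \<le> 1"
  have "norm (poly p r) \<le> (\<Sum>i\<le>degree p. norm (coeff p i) * norm r ^ i)"
    unfolding poly_altdef by (rule order_trans[OF norm_sum]) (simp add: norm_mult norm_power)
  also have "\<dots> \<le> (\<Sum>i\<le>degree p. norm (coeff p i))"
    using r by (intro sum_mono mult_right_le_one_le power_le_one) auto
  finally show "norm (poly p r) \<le> (\<Sum>i\<le>degree p. norm (coeff p i))" .
qed

text \<open>In the variable \<open>r\<close> the integrand \<open>(z - 1) * F\<^sub>s / (2 * z)\<close> is \<open>F\<^sub>s / (2 * (1 - r))\<close>, so \<open>dE\<^sub>s/dr\<close> is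
  \<open>F\<^sub>s / (2 * r\<^sup>2 * (1 - r))\<close>. The base point \<open>z = 0\<close> corresponds to \<open>r = 1\<close>.\<close>

lemma E_minus_eq_poly:
  assumes "s \<ge> 1"
  obtains e where "[:0, 0, -1, 1:] * pderiv e = smult (-1 / 2) (Fpoly s)" "poly e 1 = 0"
    "\<And>\<theta>. E_minus s (- \<i> * of_real \<theta>) = poly e (rr \<theta>)"
proof -
  obtain h where h: "Fpoly s = [:0, 0, -1, 1:] * h"
    using dvd_Fpoly_Suc[of "s - 1"] assms by (auto elim: dvdE)
  obtain e where e: "pderiv e = smult (-1 / 2) h" "poly e 1 = 0"
    using ex_poly_antiderivative by blast
  have "E_minus s (- \<i> * of_real \<theta>) = poly e (rr \<theta>)" for \<theta>
  proof (cases "\<theta> = 0")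
    case True
    then show ?thesis using e by (simp add: E_minus_def)
  next
    case False
    let ?c = "- \<i> * of_real \<theta>"
    have lp: "linepath 0 ?c u = - \<i> * of_real (u * \<theta>)" for u
      by (simp add: linepath_def scaleR_conv_of_real)
    have "((\<lambda>u. poly e (rr (u * \<theta>))) has_vector_derivative
        \<theta> *\<^sub>R (- \<i> * (rr (u * \<theta>))\<^sup>2 * poly (pderiv e) (rr (u * \<theta>)))) (at u within {0..1})" for u
    proof -
      have "((\<lambda>u. u * \<theta>) has_vector_derivative \<theta>) (at u within {0..1})"
        by (auto intro!: derivative_eq_intros)
      from vector_diff_chain_within[OF this has_vector_derivative_poly_rr[of e]] show ?thesis
        by (simp add: o_def)
    qed
    from fundamental_theorem_of_calculus[OF _ this]
    have I: "((\<lambda>u. \<theta> *\<^sub>R (- \<i> * (rr (u * \<theta>))\<^sup>2 * poly (pderiv e) (rr (u * \<theta>)))) has_integral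
        poly e (rr \<theta>)) {0..1}"
      using e by simp
    have "((\<lambda>u. ((linepath 0 ?c u - 1) * F_minus s (linepath 0 ?c u) / (2 * linepath 0 ?c u)) * (?c - 0)) has_integral
        poly e (rr \<theta>)) {0..1}"
    proof (rule has_integral_spike_finite[OF _ _ I, of "{0}"])
      fix u :: real assume u: "u \<in> {0..1} - {0}"
      define x where "x = u * \<theta>"
      have x: "x \<noteq> 0" using u False by (simp add: x_def)
      have nz: "- \<i> * of_real x \<noteq> 1" by (simp add: complex_eq_iff)
      have "(linepath 0 ?c u - 1) * F_minus s (linepath 0 ?c u) / (2 * linepath 0 ?c u)
          = (- \<i> * of_real x - 1) * poly (Fpoly s) (rr x) / (2 * (- \<i> * of_real x))"
        unfolding lp x_def[symmetric] using F_minus_eq_poly[OF nz, of s] by (simp add: rr_def)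
      also have "\<dots> = (rr x)\<^sup>2 * poly (pderiv e) (rr x)"
      proof -
        have "- \<i> * of_real x - 1 = - 1 / rr x" by (simp add: rr_def)
        moreover have "poly (Fpoly s) (rr x) = (rr x)\<^sup>2 * (rr x - 1) * poly h (rr x)"
          by (simp add: h algebra_simps power2_eq_square)
        then have "poly (Fpoly s) (rr x) = (rr x)\<^sup>2 * (- \<i> * of_real x * rr x) * poly h (rr x)"
          using i_theta_rr[of x] by (simp only: minus_diff_eq mult_minus_left)
        moreover have "- 1 / w * (w\<^sup>2 * (- \<i> * k * w) * y) / (2 * (- \<i> * k)) = w\<^sup>2 * (- 1 / 2 * y)"
          if "w \<noteq> 0" "k \<noteq> 0" for w k y :: complex
          using that by (simp add: field_simps)
        ultimately show ?thesis using x e by simp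
      qed
      finally show "((linepath 0 ?c u - 1) * F_minus s (linepath 0 ?c u) / (2 * linepath 0 ?c u)) * (?c - 0)
          = \<theta> *\<^sub>R (- \<i> * (rr (u * \<theta>))\<^sup>2 * poly (pderiv e) (rr (u * \<theta>)))"
        by (simp add: x_def scaleR_conv_of_real)
    qed auto
    then have "((\<lambda>t. (t - 1) * F_minus s t / (2 * t)) has_contour_integral poly e (rr \<theta>)) (linepath 0 ?c)"
      unfolding has_contour_integral_linepath by simp
    then show ?thesis
      unfolding E_minus_def by (rule contour_integral_unique)
  qed
  moreover have "[:0, 0, -1, 1:] * pderiv e = smult (-1 / 2) (Fpoly s)"
    unfolding e h by simp
  ultimately show ?thesis using that e by blast
qed

section \<open>The truncated Riccati equation\<close>

text \<open>The coefficients of \<open>B = a * (A - 1)\<close> in powers of \<open>1 / a\<close>, where \<open>A\<close> is the reciprocal of the formal series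
  for the amplitude \<open>J\<close>. The term \<open>F\<^sub>0\<close> enters without the factor \<open>1/2\<close>, which is why \<open>s = 0\<close> is
  treated separately.\<close>

definition riccati_coeff :: "nat \<Rightarrow> complex poly" where
  "riccati_coeff s = (if s = 0 then - Fpoly 0 else smult (- ((-1) ^ s) / 2) (Fpoly s))"

text \<open>The coefficients of \<open>B + F\<^sub>0\<close>, formally the logarithmic derivative of \<open>J\<close> with respect to \<open>z / (1 - z) * d/dz\<close>.\<close>

definition riccati_coeff_pos :: "nat \<Rightarrow> complex poly" where
  "riccati_coeff_pos s = (if s = 0 then 0 else riccati_coeff s)"

lemma riccati_coeff_convolution:
  assumes "n \<ge> 1"
  shows "(\<Sum>i\<le>n. riccati_coeff i * riccati_coeff_pos (n - i)) = smult ((-1) ^ n / 4) (\<Sum>j\<le>n. Fpoly j * Fpoly (n - j))"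
proof -
  obtain m where n: "n = Suc m" using assms by (cases n) auto
  have split: "(\<Sum>i\<le>n. g i) = g 0 + g n + (\<Sum>i\<in>{1..m}. g i)" for g :: "nat \<Rightarrow> complex poly"
  proof -
    have "{..n} = insert 0 (insert n {1..m})" using n by auto
    then show ?thesis using n by (simp add: add.assoc)
  qed
  have sgn: "(-1) ^ i * (-1) ^ (n - i) = (-1 :: complex) ^ n" if "i \<le> n" for i
    using that by (simp flip: power_add)
  have "(\<Sum>i\<in>{1..m}. riccati_coeff i * riccati_coeff_pos (n - i))
      = (\<Sum>i\<in>{1..m}. smult ((-1) ^ n / 4) (Fpoly i * Fpoly (n - i)))"
  proof (intro sum.cong refl)
    fix i assume i: "i \<in> {1..m}"
    then have "riccati_coeff i * riccati_coeff_pos (n - i) = smult (((-1) ^ i * (-1) ^ (n - i)) / 4) (Fpoly i * Fpoly (n - i))"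
      using n by (simp add: riccati_coeff_def riccati_coeff_pos_def mult.commute)
    then show "riccati_coeff i * riccati_coeff_pos (n - i) = smult ((-1) ^ n / 4) (Fpoly i * Fpoly (n - i))"
      using sgn[of i] i n by simp
  qed
  moreover have "riccati_coeff 0 * riccati_coeff_pos n = smult ((-1) ^ n / 4) (Fpoly 0 * Fpoly n + Fpoly n * Fpoly 0)"
  proof -
    have "smult (c / 4) (p + p) = smult (c / 2) p" for c and p :: "complex poly"
      by (rule poly_eqI) (simp only: coeff_smult coeff_add, simp)
    then show ?thesis
      using assms by (simp add: riccati_coeff_def riccati_coeff_pos_def mult.commute[of "Fpoly n"] del: Fpoly.simps)
  qed
  moreover have "riccati_coeff n * riccati_coeff_pos 0 = 0" by (simp add: riccati_coeff_pos_def)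
  moreover have "smult c (sum g S) = (\<Sum>i\<in>S. smult c (g i))" for c and g :: "nat \<Rightarrow> complex poly" and S
    by (induction S rule: infinite_finite_induct) (simp_all add: smult_add_right)
  ultimately show ?thesis
    unfolding split by (simp add: smult_add_right del: Fpoly.simps)
qed

lemma Dpoly_smult: "Dpoly (smult c p) = smult c (Dpoly p)"
  by (simp add: Dpoly_def pderiv_smult)

lemma Dpoly_minus: "Dpoly (- p) = - Dpoly p"
  by (simp only: Dpoly_def pderiv_minus mult_minus_right)

text \<open>The formal Riccati equation \<open>A * (B + F\<^sub>0) + D B / a = 0\<close>, \<open>A = 1 + B / a\<close>, coefficient by coefficient. It is
  the recursion that defines \<open>F\<^sub>s\<close>.\<close>

lemma riccati_coeff_recursion: "riccati_coeff (Suc n) + (\<Sum>i\<le>n. riccati_coeff i * riccati_coeff_pos (n - i)) + Dpoly (riccati_coeff n) = 0"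
proof (cases n)
  case 0
  have "Dpoly (- Fpoly 0) = - Dpoly (Fpoly 0)"
    using Dpoly_smult[of "-1" "Fpoly 0"] by (simp del: Fpoly.simps)
  then show ?thesis using 0 by (simp add: riccati_coeff_def riccati_coeff_pos_def)
next
  case (Suc m)
  then have n: "n \<ge> 1" by simp
  have "riccati_coeff (Suc n) = smult ((-1) ^ n / 2) (Dpoly (Fpoly n)) - smult ((-1) ^ n / 4) (\<Sum>j\<le>n. Fpoly j * Fpoly (n - j))"
    unfolding riccati_coeff_def Suc Fpoly.simps by (simp add: smult_diff_right del: Fpoly.simps sum.atMost_Suc)
  moreover have "Dpoly (riccati_coeff n) = - smult ((-1) ^ n / 2) (Dpoly (Fpoly n))"
    using n by (simp add: riccati_coeff_def Dpoly_smult Dpoly_minus del: Fpoly.simps)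
  ultimately show ?thesis unfolding riccati_coeff_convolution[OF n] by simp
qed

lemma dvd_riccati_coeff: "[:0, 1:] dvd riccati_coeff s"
proof (cases s)
  case 0
  have "riccati_coeff s = [:0, 1:] * [:-1, 1:]" using 0 by (simp add: riccati_coeff_def)
  then show ?thesis by (metis dvd_triv_left)
next
  case (Suc n)
  have "[:0, 0, -1, 1:] = [:0, 1:] * ([:0, -1, 1:] :: complex poly)" by simp
  then have "[:0, 1:] dvd Fpoly s" using dvd_Fpoly_Suc[of n] Suc by (metis dvd_mult_left)
  then show ?thesis using Suc by (simp add: riccati_coeff_def dvd_smult)
qed

lemma dvd_riccati_coeff_pos: "[:0, 0, -1, 1:] dvd riccati_coeff_pos s"
  using dvd_Fpoly_Suc[of "s - 1"] by (cases s) (auto simp: riccati_coeff_def riccati_coeff_pos_def intro: dvd_smult)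

lemma dvd_Dpoly_riccati_coeff:
  assumes "n \<ge> 1"
  shows "[:0, 0, 0, -1, 1:] dvd Dpoly (riccati_coeff n)"
proof -
  obtain h where "riccati_coeff n = [:0, 0, -1, 1:] * h"
    using dvd_riccati_coeff_pos[of n] assms by (auto simp: riccati_coeff_pos_def elim: dvdE)
  moreover have "pderiv [:0, 0, -1, 1:] = [:0, 1:] * ([:-2, 3:] :: complex poly)"
    by (simp add: pderiv_pCons)
  moreover have "[:0, 0, -1, 1:] = [:0, 1:] * ([:0, -1, 1:] :: complex poly)"
    by simp
  moreover have "(x * d) * pderiv (x * d * h) = (x * (x * d)) * (c * h + d * pderiv h)"
    if "pderiv (x * d) = x * c" for x d c :: "complex poly"
    using that by (simp only: pderiv_mult[of "x * d" h]) (simp only: algebra_simps)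
  ultimately have "Dpoly (riccati_coeff n)
      = ([:0, 1:] * [:0, 0, -1, 1:]) * ([:-2, 3:] * h + [:0, -1, 1:] * pderiv h)"
    unfolding Dpoly_def by metis
  moreover have "[:0, 1:] * [:0, 0, -1, 1:] = ([:0, 0, 0, -1, 1:] :: complex poly)"
    by simp
  ultimately have "Dpoly (riccati_coeff n) = [:0, 0, 0, -1, 1:] * ([:-2, 3:] * h + [:0, -1, 1:] * pderiv h)"
    by (simp only:)
  then show ?thesis by (metis dvd_triv_left)
qed

definition riccati_trunc :: "nat \<Rightarrow> complex \<Rightarrow> complex \<Rightarrow> complex" where
  "riccati_trunc K t r = (\<Sum>s\<le>K. t ^ s * poly (riccati_coeff s) r)"

definition riccati_trunc' :: "nat \<Rightarrow> complex \<Rightarrow> complex \<Rightarrow> complex" where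
  "riccati_trunc' K t r = (\<Sum>s\<le>K. t ^ s * poly (pderiv (riccati_coeff s)) r)"

text \<open>The left-hand side of the Riccati equation for the series truncated after \<open>K\<close> terms, with \<open>t = 1 / a\<close> and
  \<open>F\<^sub>0 = r * (1 - r)\<close>.\<close>

definition riccati_residual :: "nat \<Rightarrow> complex \<Rightarrow> complex \<Rightarrow> complex" where
  "riccati_residual K t r = (1 + t * riccati_trunc K t r) * (riccati_trunc K t r + r * (1 - r)) + t * ((r - 1) * r\<^sup>2 * riccati_trunc' K t r)"

text \<open>As a polynomial in \<open>t\<close>, the residual has no terms of degree at most \<open>K\<close> because of the formal Riccati equation,
  and each remaining coefficient is a sum of products of coefficients of \<open>B\<close> and \<open>B + F\<^sub>0\<close> and of a
  derivative \<open>D B\<close>, all divisible by \<open>(r - 1) * r\<^sup>3\<close>. The exponent 3 is what makes the final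
  error in the derivative of the phase integrable over \<open>\<theta> > 0\<close>.\<close>

lemma riccati_residual_bound:
  assumes "K \<ge> 1"
  shows "\<exists>C\<ge>0. \<forall>t r. norm t \<le> 1 \<longrightarrow> norm r \<le> 1 \<longrightarrow>
    norm (riccati_residual K t r) \<le> C * norm t ^ (K + 1) * norm (r - 1) * norm r ^ 3"
proof -
  define B where "B = (\<Sum>s\<le>K. monom (riccati_coeff s) s)"
  define BC where "BC = (\<Sum>s\<le>K. monom (riccati_coeff_pos s) s)"
  \<comment> \<open>All three are polynomials in \<open>t\<close> with coefficients in \<open>\<complex>[r]\<close>: \<open>B\<close>, \<open>B + F\<^sub>0\<close> and \<open>D B\<close>.\<close>
  define BD where "BD = (\<Sum>s\<le>K. monom (Dpoly (riccati_coeff s)) s)"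
  define T where "T = BC + pCons 0 (B * BC + BD)"
  have coeff_monoms: "coeff (\<Sum>s\<le>K. monom (g s) s) n = (if n \<le> K then g n else 0)" for g :: "nat \<Rightarrow> complex poly" and n
    by (simp add: coeff_sum)
  have T_Suc: "coeff T (Suc n) = coeff BC (Suc n) + ((\<Sum>i\<le>n. coeff B i * coeff BC (n - i)) + coeff BD n)" for n
    by (simp add: T_def coeff_mult)
  have T0: "coeff T n = 0" if "n \<le> K" for n
  proof (cases n)
    case 0
    then show ?thesis by (simp add: T_def BC_def coeff_monoms riccati_coeff_pos_def)
  next
    case (Suc m)
    have "(\<Sum>i\<le>m. coeff B i * coeff BC (m - i)) = (\<Sum>i\<le>m. riccati_coeff i * riccati_coeff_pos (m - i))"
      using that Suc by (intro sum.cong) (auto simp: B_def BC_def coeff_monoms)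
    then show ?thesis
      using riccati_coeff_recursion[of m] that Suc
      by (simp add: T_Suc BC_def BD_def coeff_monoms riccati_coeff_pos_def algebra_simps)
  qed
  have T_dvd: "[:0, 0, 0, -1, 1:] dvd coeff T n" if n: "n > K" for n
  proof -
    obtain m where m: "n = Suc m" using n by (cases n) auto
    have "[:0, 0, 0, -1, 1:] dvd coeff B i * coeff BC (m - i)" for i
    proof -
      have "[:0, 1:] * [:0, 0, -1, 1:] dvd coeff B i * coeff BC (m - i)"
        by (rule mult_dvd_mono) (auto simp: B_def BC_def coeff_monoms dvd_riccati_coeff dvd_riccati_coeff_pos)
      then show ?thesis by simp
    qed
    moreover have "[:0, 0, 0, -1, 1:] dvd coeff BD m"
      using dvd_Dpoly_riccati_coeff[of m] n m assms by (auto simp: BD_def coeff_monoms)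
    moreover have "coeff BC (Suc m) = 0" using n m by (simp add: BC_def coeff_monoms)
    ultimately show ?thesis
      unfolding m T_Suc by (simp add: dvd_add dvd_sum)
  qed
  have ev_monoms: "poly (poly (\<Sum>s\<le>K. monom (g s) s) [:t:]) r = (\<Sum>s\<le>K. t ^ s * poly (g s) r)"
    for g :: "nat \<Rightarrow> complex poly" and t r
    by (simp add: poly_sum poly_monom mult.commute)
  have B_C: "B = BC + [:riccati_coeff 0:]"
  proof -
    have "B = (\<Sum>s\<le>K. monom (riccati_coeff_pos s) s + (if s = 0 then [:riccati_coeff 0:] else 0))"
      unfolding B_def by (intro sum.cong) (auto simp: riccati_coeff_pos_def monom_0)
    then show ?thesis by (simp add: sum.distrib BC_def)
  qed
  have T_ev: "poly (poly T [:t:]) r = riccati_residual K t r" for t r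
  proof -
    have B: "poly (poly B [:t:]) r = riccati_trunc K t r"
      unfolding B_def riccati_trunc_def ev_monoms ..
    have C: "poly (poly BC [:t:]) r = riccati_trunc K t r + r * (1 - r)"
      unfolding B[symmetric] B_C by (simp add: riccati_coeff_def algebra_simps)
    have "poly (poly BD [:t:]) r = (r - 1) * r\<^sup>2 * riccati_trunc' K t r"
      unfolding BD_def ev_monoms riccati_trunc'_def sum_distrib_left
      by (intro sum.cong) (simp_all add: Dpoly_def algebra_simps power2_eq_square)
    moreover have "poly (poly T [:t:]) r = poly (poly BC [:t:]) r
        + t * (poly (poly B [:t:]) r * poly (poly BC [:t:]) r + poly (poly BD [:t:]) r)"
      by (simp add: T_def)
    ultimately have "poly (poly T [:t:]) r = riccati_trunc K t r + r * (1 - r)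
        + t * (riccati_trunc K t r * (riccati_trunc K t r + r * (1 - r)) + (r - 1) * r\<^sup>2 * riccati_trunc' K t r)"
      by (simp only: B C)
    then show ?thesis unfolding riccati_residual_def by (simp only: algebra_simps mult_1)
  qed
  have "\<exists>C\<ge>0. \<forall>r. norm r \<le> 1 \<longrightarrow> norm (poly (coeff T n) r) \<le> C * (norm (r - 1) * norm r ^ 3)" if n: "n > K" for n
  proof -
    obtain h where h: "coeff T n = [:0, 0, 0, -1, 1:] * h" using T_dvd[OF n] by (auto elim: dvdE)
    obtain C where C: "C \<ge> 0" "\<And>r. norm r \<le> 1 \<Longrightarrow> norm (poly h r) \<le> C"
      using poly_bounded_unit_disc[of h] by auto
    have "poly (coeff T n) r = poly h r * ((r - 1) * r ^ 3)" for r
      by (simp add: h algebra_simps power3_eq_cube)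
    then show ?thesis using C
      by (intro exI[of _ C]) (simp add: norm_mult norm_power mult_right_mono)
  qed
  then obtain C where C: "\<And>n. n > K \<Longrightarrow> C n \<ge> 0"
    "\<And>n r. n > K \<Longrightarrow> norm r \<le> 1 \<Longrightarrow> norm (poly (coeff T n) r) \<le> C n * (norm (r - 1) * norm r ^ 3)"
    by metis
  define C' where "C' = (\<Sum>n\<in>{K<..degree T}. C n)"
  show ?thesis
  proof (intro exI conjI allI impI)
    show "C' \<ge> 0" unfolding C'_def using C by (intro sum_nonneg) auto
    fix t r :: complex assume t: "norm t \<le> 1" and r: "norm r \<le> 1"
    have "riccati_residual K t r = (\<Sum>n\<le>degree T. poly (coeff T n) r * t ^ n)"
      unfolding T_ev[symmetric] by (simp add: poly_altdef[of T] poly_sum flip: poly_const_pow)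
    also have "\<dots> = (\<Sum>n\<in>{K<..degree T}. poly (coeff T n) r * t ^ n)"
      by (rule sum.mono_neutral_right) (auto simp: T0)
    also have "norm \<dots> \<le> (\<Sum>n\<in>{K<..degree T}. C n * (norm (r - 1) * norm r ^ 3) * norm t ^ (K + 1))"
    proof (intro order_trans[OF norm_sum] sum_mono)
      fix n assume n: "n \<in> {K<..degree T}"
      have "norm t ^ n \<le> norm t ^ (K + 1)" using n t by (intro power_decreasing) auto
      moreover have "0 \<le> C n * (norm (r - 1) * norm r ^ 3)" using n C by simp
      ultimately show "norm (poly (coeff T n) r * t ^ n) \<le> C n * (norm (r - 1) * norm r ^ 3) * norm t ^ (K + 1)"
        using C(2)[of n r] n r by (simp only: norm_mult norm_power) (intro mult_mono, auto)
    qed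
    finally show "norm (riccati_residual K t r) \<le> C' * norm t ^ (K + 1) * norm (r - 1) * norm r ^ 3"
      by (simp only: sum_distrib_right[symmetric] C'_def[symmetric]) (simp only: mult_ac)
  qed
qed

lemma riccati_trunc_bounded: "\<exists>C\<ge>0. \<forall>t r. norm t \<le> 1 \<longrightarrow> norm r \<le> 1 \<longrightarrow> norm (riccati_trunc K t r) \<le> C"
proof -
  obtain C where C: "\<And>s. C s \<ge> 0" "\<And>s r. norm r \<le> 1 \<Longrightarrow> norm (poly (riccati_coeff s) r) \<le> C s"
  proof -
    have "\<forall>s. \<exists>C. C \<ge> 0 \<and> (\<forall>r. norm r \<le> 1 \<longrightarrow> norm (poly (riccati_coeff s) r) \<le> C)"
      using poly_bounded_unit_disc by blast
    then show ?thesis using that by metis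
  qed
  show ?thesis
  proof (intro exI conjI allI impI)
    show "0 \<le> (\<Sum>s\<le>K. C s)" using C by (simp add: sum_nonneg)
    fix t r :: complex assume t: "norm t \<le> 1" and r: "norm r \<le> 1"
    have "norm (t ^ s * poly (riccati_coeff s) r) \<le> C s" for s
      using mult_mono[of "norm t ^ s" 1 "norm (poly (riccati_coeff s) r)" "C s"] C t r
      by (simp add: norm_mult norm_power power_le_one)
    then show "norm (riccati_trunc K t r) \<le> (\<Sum>s\<le>K. C s)"
      unfolding riccati_trunc_def by (intro order_trans[OF norm_sum] sum_mono)
  qed
qed

lemma riccati_trunc_at_1: "riccati_trunc K t 1 = 0"
proof -
  have "poly (riccati_coeff s) 1 = 0" for s
  proof (cases "s = 0")
    case False
    obtain k where "riccati_coeff_pos s = [:0, 0, -1, 1:] * k" using dvd_riccati_coeff_pos by (rule dvdE)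
    then have "poly (riccati_coeff_pos s) 1 = 0" by (simp only: poly_mult) simp
    then show ?thesis using False by (simp add: riccati_coeff_pos_def)
  qed (simp add: riccati_coeff_def)
  then show ?thesis by (simp add: riccati_trunc_def)
qed

section \<open>The sine integral against its truncated expansion\<close>

definition Si_complex :: "real \<Rightarrow> real \<Rightarrow> complex" where
  "Si_complex a \<theta> = integral {0..a * \<theta>} (\<lambda>u. of_real (u powr (a - 1)) * cis u)"

text \<open>The contribution of the end point \<open>u = a * \<theta>\<close> to the integral, by one integration by parts.\<close>

definition leading_term :: "real \<Rightarrow> real \<Rightarrow> complex" where
  "leading_term a \<theta> = cis (a * \<theta>) * of_real ((a * \<theta>) powr a / a) * rr \<theta>"

definition inv_amplitude :: "nat \<Rightarrow> real \<Rightarrow> real \<Rightarrow> complex" where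
  "inv_amplitude K a \<theta> = 1 + of_real (1 / a) * riccati_trunc K (of_real (1 / a)) (rr \<theta>)"

lemma continuous_on_Si_complex_integrand:
  assumes "a > 1" "S \<subseteq> {0..}"
  shows "continuous_on S (\<lambda>u. complex_of_real (u powr (a - 1)) * cis u)"
  using assms by (intro continuous_intros continuous_on_powr') auto

lemma Im_Si_complex:
  assumes "a > 1"
  shows "Im (Si_complex a \<theta>) = Si a (a * \<theta>)"
proof -
  have "(\<lambda>u. complex_of_real (u powr (a - 1)) * cis u) integrable_on {0..a * \<theta>}"
    using assms by (intro integrable_continuous_real continuous_on_Si_complex_integrand) auto
  from integral_linear[OF this bounded_linear_Im] show ?thesis
    by (simp add: Si_complex_def Si_def o_def)
qed

lemma Si_complex_0 [simp]: "Si_complex a 0 = 0"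
  by (simp add: Si_complex_def)

lemma continuous_on_Si_complex:
  assumes "a > 1"
  shows "continuous_on {0..b} (Si_complex a)"
proof -
  have "continuous_on {0..a * b} (\<lambda>x. integral {0..x} (\<lambda>u. complex_of_real (u powr (a - 1)) * cis u))"
    using assms
    by (intro indefinite_integral_continuous_1 integrable_continuous_real continuous_on_Si_complex_integrand) auto
  from continuous_on_compose2[OF this, of "{0..b}" "\<lambda>\<theta>. a * \<theta>"] assms show ?thesis
    by (auto simp: Si_complex_def[abs_def] intro!: continuous_intros mult_left_mono)
qed

lemma has_vector_derivative_Si_complex:
  assumes "a > 1" "\<theta> > 0"
  shows "(Si_complex a has_vector_derivative leading_term a \<theta> * (of_real a / (rr \<theta> * of_real \<theta>))) (at \<theta>)"
proof -
  let ?f = "\<lambda>u. complex_of_real (u powr (a - 1)) * cis u"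
  have "((\<lambda>x. integral {0..x} ?f) has_vector_derivative ?f (a * \<theta>)) (at (a * \<theta>) within {0..a * \<theta> + 1})"
    using assms by (intro integral_has_vector_derivative continuous_on_Si_complex_integrand) auto
  then have "((\<lambda>x. integral {0..x} ?f) has_vector_derivative ?f (a * \<theta>)) (at (a * \<theta>))"
    using assms by (simp add: at_within_Icc_at)
  moreover have "((\<lambda>\<theta>. a * \<theta>) has_vector_derivative a) (at \<theta>)"
    by (auto intro!: derivative_eq_intros)
  ultimately have "(Si_complex a has_vector_derivative a *\<^sub>R ?f (a * \<theta>)) (at \<theta>)"
    using vector_diff_chain_at[of "\<lambda>\<theta>. a * \<theta>" a \<theta> "\<lambda>x. integral {0..x} ?f" "?f (a * \<theta>)"]
    by (simp add: o_def Si_complex_def[abs_def])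
  moreover have "a *\<^sub>R ?f (a * \<theta>) = leading_term a \<theta> * (of_real a / (rr \<theta> * of_real \<theta>))"
  proof -
    have p: "(a * \<theta>) powr (a - 1) = (a * \<theta>) powr a / (a * \<theta>)"
      using assms by (simp add: powr_diff)
    show ?thesis unfolding p using assms by (simp add: leading_term_def scaleR_conv_of_real)
  qed
  ultimately show ?thesis by simp
qed

lemma has_vector_derivative_cis_mult:
  "((\<lambda>\<theta>. cis (a * \<theta>)) has_vector_derivative \<i> * of_real a * cis (a * \<theta>)) (at \<theta>)"
proof -
  have "((\<lambda>\<theta>. cis (a * \<theta>)) has_derivative (\<lambda>t. (a * t) *\<^sub>R (\<i> * cis (a * \<theta>)))) (at \<theta>)"
    by (auto intro!: derivative_eq_intros)
  then show ?thesis
    by (simp add: has_vector_derivative_def scaleR_conv_of_real mult_ac)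
qed

lemma has_vector_derivative_leading_term:
  assumes "a > 1" "\<theta> > 0"
  shows "(leading_term a has_vector_derivative
    leading_term a \<theta> * (of_real a / (rr \<theta> * of_real \<theta>) - \<i> * rr \<theta>)) (at \<theta>)"
proof -
  let ?p = "(a * \<theta>) powr a / a"
  have "((\<lambda>\<theta>. (a * \<theta>) powr a / a) has_field_derivative a * ((a * \<theta>) powr (a - 1))) (at \<theta>)"
    using assms by (auto intro!: derivative_eq_intros)
  also have "a * ((a * \<theta>) powr (a - 1)) = a / \<theta> * ?p"
    using assms by (simp add: powr_diff field_simps)
  finally have "(leading_term a has_vector_derivative (cis (a * \<theta>) * of_real ?p) * (- \<i> * (rr \<theta>)\<^sup>2)
      + (cis (a * \<theta>) * of_real (a / \<theta> * ?p) + \<i> * of_real a * cis (a * \<theta>) * of_real ?p) * rr \<theta>) (at \<theta>)"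
    unfolding leading_term_def[abs_def]
    by (intro has_vector_derivative_mult has_vector_derivative_cis_mult has_vector_derivative_of_real
          has_vector_derivative_rr)
  moreover have "of_real a / (rr \<theta> * of_real \<theta>) = of_real (a / \<theta>) + \<i> * of_real a"
    using assms by (simp add: rr_def field_simps)
  moreover have "(c * p) * (- \<i> * r\<^sup>2) + (c * (q * p) + \<i> * b * c * p) * r = c * p * r * ((q + \<i> * b) - \<i> * r)"
    for c p q r b :: complex
    by (simp add: algebra_simps power2_eq_square)
  ultimately show ?thesis
    by (simp only: leading_term_def of_real_mult)
qed

lemma has_vector_derivative_inv_amplitude:
  "(inv_amplitude K a has_vector_derivative
     of_real (1 / a) * (- \<i> * (rr \<theta>)\<^sup>2 * riccati_trunc' K (of_real (1 / a)) (rr \<theta>))) (at \<theta> within S)"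
proof -
  have "((\<lambda>\<theta>. riccati_trunc K (of_real (1 / a)) (rr \<theta>)) has_vector_derivative
      (\<Sum>s\<le>K. of_real (1 / a) ^ s * (- \<i> * (rr \<theta>)\<^sup>2 * poly (pderiv (riccati_coeff s)) (rr \<theta>)))) (at \<theta> within S)"
    unfolding riccati_trunc_def
    by (intro has_vector_derivative_sum has_vector_derivative_mult_right has_vector_derivative_poly_rr)
  also have "(\<Sum>s\<le>K. of_real (1 / a) ^ s * (- \<i> * (rr \<theta>)\<^sup>2 * poly (pderiv (riccati_coeff s)) (rr \<theta>)))
      = - \<i> * (rr \<theta>)\<^sup>2 * riccati_trunc' K (of_real (1 / a)) (rr \<theta>)"
    unfolding riccati_trunc'_def sum_distrib_left by (intro sum.cong) (simp_all add: mult_ac)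
  finally show ?thesis
    unfolding inv_amplitude_def[abs_def]
    by (auto intro!: derivative_eq_intros)
qed

text \<open>The logarithmic derivative of the leading term is \<open>a / (r * \<theta>) - \<i> * r\<close>. Inserting it, and using
  \<open>\<i> * \<theta> * r = 1 - r\<close>, the derivative of \<open>H - M / A\<close> becomes a multiple of the Riccati residual.\<close>

lemma has_vector_derivative_error:
  assumes "a > 1" "\<theta> > 0" "inv_amplitude K a \<theta> \<noteq> 0"
  shows "((\<lambda>\<theta>. Si_complex a \<theta> - leading_term a \<theta> * inverse (inv_amplitude K a \<theta>)) has_vector_derivative
    leading_term a \<theta> * (riccati_residual K (of_real (1 / a)) (rr \<theta>) / (rr \<theta> * of_real \<theta> * (inv_amplitude K a \<theta>)\<^sup>2))) (at \<theta>)"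
proof -
  define A A' where "A = inv_amplitude K a \<theta>"
    and "A' = of_real (1 / a) * (- \<i> * (rr \<theta>)\<^sup>2 * riccati_trunc' K (of_real (1 / a)) (rr \<theta>))"
  define P where "P = of_real a / (rr \<theta> * of_real \<theta>)"
  have A: "A \<noteq> 0" using assms by (simp add: A_def)
  have "((\<lambda>\<theta>. inverse (inv_amplitude K a \<theta>)) has_vector_derivative A' * - inverse (A\<^sup>2)) (at \<theta>)"
    using field_vector_diff_chain_at[OF has_vector_derivative_inv_amplitude DERIV_inverse[OF assms(3)]]
    unfolding A_def A'_def o_def numeral_2_eq_2 power_inverse .
  from has_vector_derivative_diff[OF has_vector_derivative_Si_complex has_vector_derivative_mult[OF has_vector_derivative_leading_term this]]
  have "((\<lambda>\<theta>. Si_complex a \<theta> - leading_term a \<theta> * inverse (inv_amplitude K a \<theta>)) has_vector_derivative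
      leading_term a \<theta> * P - (leading_term a \<theta> * (A' * - inverse (A\<^sup>2)) + leading_term a \<theta> * (P - \<i> * rr \<theta>) * inverse A)) (at \<theta>)"
    using assms by (simp add: A_def P_def)
  moreover have "leading_term a \<theta> * P - (leading_term a \<theta> * (A' * - inverse (A\<^sup>2)) + leading_term a \<theta> * (P - \<i> * rr \<theta>) * inverse A)
      = leading_term a \<theta> * (P - (P - \<i> * rr \<theta>) / A + A' / A\<^sup>2)"
    by (simp only: divide_inverse) (simp add: algebra_simps)
  moreover have "P - (P - \<i> * rr \<theta>) / A + A' / A\<^sup>2
      = riccati_residual K (of_real (1 / a)) (rr \<theta>) / (rr \<theta> * of_real \<theta> * A\<^sup>2)"
  proof -
    define t r k B B' where "t = complex_of_real (1 / a)" and "r = rr \<theta>" and "k = complex_of_real \<theta>"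
      and "B = riccati_trunc K t r" and "B' = riccati_trunc' K t r"
    have nz: "r \<noteq> 0" "k \<noteq> 0" and ta: "t * of_real a = 1" and ikr: "\<i> * k * r = 1 - r"
      using assms i_theta_rr[of \<theta>] by (auto simp: r_def k_def t_def)
    have AB: "A = 1 + t * B" by (simp add: A_def inv_amplitude_def t_def B_def r_def)
    have "P - (P - \<i> * rr \<theta>) / A + A' / A\<^sup>2
       = (of_real a * A\<^sup>2 - (of_real a - (\<i> * k * r) * r) * A - t * ((\<i> * k * r) * r\<^sup>2 * B')) / (r * k * A\<^sup>2)"
    proof -
      have "P = of_real a * A\<^sup>2 / (r * k * A\<^sup>2)"
        using A by (simp add: P_def r_def k_def)
      moreover have "(P - \<i> * rr \<theta>) / A = (of_real a - (\<i> * k * r) * r) * A / (r * k * A\<^sup>2)"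
      proof -
        have "P - \<i> * rr \<theta> = (of_real a - (\<i> * k * r) * r) / (r * k)"
          using nz by (simp add: P_def diff_divide_distrib flip: r_def k_def)
        then show ?thesis using A by (simp add: power2_eq_square)
      qed
      moreover have "A' / A\<^sup>2 = - (t * ((\<i> * k * r) * r\<^sup>2 * B')) / (r * k * A\<^sup>2)"
      proof -
        have "A' = t * (- \<i> * r\<^sup>2 * B')" by (simp only: A'_def t_def r_def B'_def)
        then show ?thesis using nz by (simp add: mult_ac)
      qed
      ultimately show ?thesis
        by (simp only: diff_divide_distrib add_divide_distrib minus_divide_left) simp
    qed
    also have "of_real a * A\<^sup>2 - (of_real a - (\<i> * k * r) * r) * A - t * ((\<i> * k * r) * r\<^sup>2 * B')
       = A * ((t * of_real a) * B + r * (1 - r)) + t * ((r - 1) * r\<^sup>2 * B')"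
      unfolding ikr AB by (simp add: algebra_simps power2_eq_square)
    also have "\<dots> = riccati_residual K t r"
      by (simp add: riccati_residual_def ta AB B_def B'_def)
    finally show ?thesis by (simp add: t_def r_def k_def)
  qed
  ultimately show ?thesis by (simp add: A_def)
qed

text \<open>Monotonicity of \<open>\<theta> / sqrt (1 + \<theta>\<^sup>2)\<close>. It allows the decay \<open>r\<^sup>4\<close> at an intermediate point \<open>u\<close> to be
  replaced by decay at the end point, at the price of powers of \<open>\<theta> / u\<close>.\<close>

lemma theta_rr_mono:
  assumes "0 < u" "u \<le> \<theta>"
  shows "u * norm (rr u) \<le> \<theta> * norm (rr \<theta>)"
proof (rule power2_le_imp_le)
  have "u\<^sup>2 \<le> \<theta>\<^sup>2" using assms by simp
  then show "(u * norm (rr u))\<^sup>2 \<le> (\<theta> * norm (rr \<theta>))\<^sup>2"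
    by (simp add: power_mult_distrib norm_rr_sq divide_simps add_pos_nonneg algebra_simps)
  show "0 \<le> \<theta> * norm (rr \<theta>)" using assms by simp
qed

lemma theta_rr_le_1: "\<bar>\<theta>\<bar> * norm (rr \<theta>) \<le> 1"
proof (rule power2_le_imp_le)
  show "(\<bar>\<theta>\<bar> * norm (rr \<theta>))\<^sup>2 \<le> 1\<^sup>2"
    by (simp add: power_mult_distrib norm_rr_sq divide_simps add_pos_nonneg)
qed simp

lemma norm_leading_term:
  assumes "a > 0"
  shows "norm (leading_term a \<theta>) = (a * \<theta>) powr a / a * norm (rr \<theta>)"
  using assms by (simp add: leading_term_def norm_mult norm_divide)

text \<open>The difference \<open>H - M / A\<close> vanishes at 0, and its derivative is at most a constant times \<open>u powr (a - 4)\<close> on \<open>(0, \<theta>)\<close>.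
  Integration yields a factor \<open>1 / (a - 3) \<le> 2 / a\<close>, hence one more power of \<open>1 / a\<close> than the residual has.\<close>

lemma Si_complex_ratio_approx:
  assumes C: "C \<ge> 0" "\<And>r. norm r \<le> 1 \<Longrightarrow>
      norm (riccati_residual K (of_real (1 / a)) r) \<le> C * (1 / a) ^ (K + 1) * norm (r - 1) * norm r ^ 3"
    and A: "\<And>\<theta>. norm (inv_amplitude K a \<theta>) \<ge> 1 / 2"
    and a: "a \<ge> 6" and \<theta>: "\<theta> > 0"
  shows "norm (Si_complex a \<theta> / leading_term a \<theta> - inverse (inv_amplitude K a \<theta>)) \<le> 8 * C * (1 / a) ^ (K + 2) * \<theta> * norm (rr \<theta>) ^ 3"
proof -
  \<comment> \<open>\<open>G * u powr (a - 4)\<close> dominates the derivative of \<open>H - M / A\<close> at every \<open>u < \<theta>\<close>.\<close>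
  define G where "G = 4 * C * (1 / a) ^ (K + 2) * a powr a * (\<theta> * norm (rr \<theta>)) ^ 4"
  define Q where "Q = (\<lambda>\<theta>. Si_complex a \<theta> - leading_term a \<theta> * inverse (inv_amplitude K a \<theta>))"
  have nz: "inv_amplitude K a u \<noteq> 0" for u using A[of u] by auto
  have "norm (Q \<theta> - Q 0) \<le> G / (a - 3) * \<theta> powr (a - 3) - G / (a - 3) * 0 powr (a - 3)"
  proof (rule differentiable_bound_general[OF \<theta>])
    show "continuous_on {0..\<theta>} Q"
      unfolding Q_def
      using a nz has_vector_derivative_inv_amplitude
      by (intro continuous_on_diff continuous_on_Si_complex continuous_on_mult continuous_on_inverse)
        (auto simp: leading_term_def[abs_def] intro!: continuous_intros continuous_on_powr'
          continuous_on_vector_derivative[OF has_vector_derivative_rr]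
          continuous_on_vector_derivative[OF has_vector_derivative_inv_amplitude])
    show "continuous_on {0..\<theta>} (\<lambda>u. G / (a - 3) * u powr (a - 3))"
      using a by (intro continuous_intros continuous_on_powr') auto
    fix u assume u: "0 < u" "u < \<theta>"
    show "(Q has_vector_derivative
        leading_term a u * (riccati_residual K (of_real (1 / a)) (rr u) / (rr u * of_real u * (inv_amplitude K a u)\<^sup>2))) (at u)"
      unfolding Q_def using a u nz by (intro has_vector_derivative_error) auto
    have "((\<lambda>u. G / (a - 3) * u powr (a - 3)) has_field_derivative G * u powr (a - 4)) (at u)"
      using a u by (auto intro!: derivative_eq_intros)
    then show "((\<lambda>u. G / (a - 3) * u powr (a - 3)) has_vector_derivative G * u powr (a - 4)) (at u)"
      by (simp add: has_real_derivative_iff_has_vector_derivative)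
    show "norm (leading_term a u * (riccati_residual K (of_real (1 / a)) (rr u) / (rr u * of_real u * (inv_amplitude K a u)\<^sup>2)))
        \<le> G * u powr (a - 4)"
    proof -
      have T: "norm (riccati_residual K (of_real (1 / a)) (rr u)) \<le> C * (1 / a) ^ (K + 1) * (u * norm (rr u)) * norm (rr u) ^ 3"
        using C(2)[of "rr u"] u by (simp add: norm_rr_le_1 norm_rr_diff_1)
      have A2: "1 / (norm (inv_amplitude K a u))\<^sup>2 \<le> 4"
      proof -
        have "(1 / 2)\<^sup>2 \<le> (norm (inv_amplitude K a u))\<^sup>2" using A[of u] by (intro power_mono) auto
        then show ?thesis using nz[of u] by (simp add: field_simps power2_eq_square)
      qed
      have "norm (leading_term a u * (riccati_residual K (of_real (1 / a)) (rr u) / (rr u * of_real u * (inv_amplitude K a u)\<^sup>2)))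
         = (a * u) powr a / a / u * norm (riccati_residual K (of_real (1 / a)) (rr u)) * (1 / (norm (inv_amplitude K a u))\<^sup>2)"
        using a u by (simp add: norm_mult norm_divide norm_power norm_leading_term)
      also have "\<dots> \<le> (a * u) powr a / a / u * (C * (1 / a) ^ (K + 1) * (u * norm (rr u)) * norm (rr u) ^ 3) * 4"
        using a u C by (intro mult_mono T A2 order_refl) auto
      also have "\<dots> = 4 * C * (1 / a) ^ (K + 2) * (a * u) powr a * norm (rr u) ^ 4"
      proof -
        have "p / a / u * (C * x * (u * n) * m) * 4 = 4 * C * (x * (1 / a)) * p * (n * m)" for p x n m :: real
          using a u by simp
        moreover have "(1 / a) ^ (K + 2) = (1 / a) ^ (K + 1) * (1 / a)"
          "norm (rr u) ^ 4 = norm (rr u) * norm (rr u) ^ 3"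
          by (simp_all add: power4_eq_xxxx power3_eq_cube)
        ultimately show ?thesis by (simp only:)
      qed
      also have "(a * u) powr a = a powr a * (u powr (a - 4) * u ^ 4)"
      proof -
        have "u powr a = u powr (a - 4) * u powr 4" by (simp flip: powr_add)
        then show ?thesis using a u powr_realpow[of u 4] by (simp add: powr_mult)
      qed
      also have "4 * C * (1 / a) ^ (K + 2) * (a powr a * (u powr (a - 4) * u ^ 4)) * norm (rr u) ^ 4
         = 4 * C * (1 / a) ^ (K + 2) * a powr a * (u * norm (rr u)) ^ 4 * u powr (a - 4)"
        by (simp add: power_mult_distrib)
      also have "\<dots> \<le> G * u powr (a - 4)"
        unfolding G_def using theta_rr_mono[of u \<theta>] u C a
        by (intro mult_right_mono mult_left_mono power_mono) auto
      finally show ?thesis .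
    qed
  qed
  moreover have "Q 0 = 0" using a by (simp add: Q_def leading_term_def)
  ultimately have "norm (Q \<theta>) \<le> G / (a - 3) * \<theta> powr (a - 3)" using a by simp
  also have "\<dots> \<le> G * (2 / a) * \<theta> powr (a - 3)"
  proof -
    have "1 / (a - 3) \<le> 2 / a" using a by (simp add: field_simps)
    then have "G * (1 / (a - 3)) \<le> G * (2 / a)"
      using C a by (intro mult_left_mono) (auto simp: G_def)
    then show ?thesis by (intro mult_right_mono) auto
  qed
  also have "\<dots> = (8 * C * (1 / a) ^ (K + 2) * \<theta> * norm (rr \<theta>) ^ 3) * norm (leading_term a \<theta>)"
  proof -
    have "\<theta> powr (a - 3) = \<theta> powr a / \<theta> ^ 3"
      using \<theta> powr_realpow[of \<theta> 3] by (simp add: powr_diff)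
    then have "\<theta> ^ 4 * \<theta> powr (a - 3) = \<theta> * \<theta> powr a"
      using \<theta> by (simp add: power4_eq_xxxx power3_eq_cube)
    moreover have "G * (2 / a) * \<theta> powr (a - 3)
        = 8 * C * (1 / a) ^ (K + 2) * (a powr a / a) * norm (rr \<theta>) ^ 4 * (\<theta> ^ 4 * \<theta> powr (a - 3))"
      by (simp add: G_def power_mult_distrib)
    ultimately show ?thesis
      using a \<theta> by (simp add: norm_leading_term powr_mult power4_eq_xxxx power3_eq_cube)
  qed
  finally have Q: "norm (Q \<theta>) \<le> (8 * C * (1 / a) ^ (K + 2) * \<theta> * norm (rr \<theta>) ^ 3) * norm (leading_term a \<theta>)" .
  have M: "norm (leading_term a \<theta>) > 0" using a \<theta> by (simp add: norm_leading_term)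
  have "Si_complex a \<theta> / leading_term a \<theta> - inverse (inv_amplitude K a \<theta>) = Q \<theta> / leading_term a \<theta>"
    using M by (simp add: Q_def field_simps)
  then show ?thesis
    using Q M by (simp add: norm_divide divide_le_eq)
qed

section \<open>The truncated phase\<close>

text \<open>The derivatives are carried along explicitly, so that iterated \<open>deriv\<close> never has to be computed.\<close>

definition smooth_bdd :: "(real \<Rightarrow> real) \<Rightarrow> bool" where
  "smooth_bdd f \<longleftrightarrow> (\<exists>D. D 0 = f \<and> (\<forall>n x. (D n has_real_derivative D (Suc n) x) (at x))
     \<and> (\<forall>n. \<exists>C. \<forall>x. \<bar>D n x :: real\<bar> \<le> C))"

text \<open>Differentiation with respect to \<open>\<theta>\<close> of a polynomial in \<open>r = 1 / (1 + \<i> * \<theta>)\<close>, since \<open>dr/d\<theta> = - \<i> * r\<^sup>2\<close>. As this is again a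
  polynomial and \<open>\<bar>r\<bar> \<le> 1\<close>, all derivatives of such functions are bounded.\<close>

definition theta_deriv :: "complex poly \<Rightarrow> complex poly" where
  "theta_deriv p = [:0, 0, - \<i>:] * pderiv p"

lemma has_real_derivative_Im_poly_rr:
  "((\<lambda>\<theta>. Im (poly p (rr \<theta>))) has_real_derivative Im (poly (theta_deriv p) (rr \<theta>))) (at \<theta>)"
proof -
  have "- \<i> * (rr \<theta>)\<^sup>2 * poly (pderiv p) (rr \<theta>) = poly (theta_deriv p) (rr \<theta>)"
    by (simp add: theta_deriv_def power2_eq_square)
  then show ?thesis
    using bounded_linear.has_vector_derivative[OF bounded_linear_Im has_vector_derivative_poly_rr[of p \<theta> UNIV]]
    by (simp add: has_real_derivative_iff_has_vector_derivative)
qed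

lemma Im_poly_rr_bounded: "\<exists>C. \<forall>\<theta>. \<bar>Im (poly p (rr \<theta>))\<bar> \<le> C"
  using poly_bounded_unit_disc[of p] norm_rr_le_1 abs_Im_le_cmod order_trans by meson

lemma smooth_bdd_Im_poly_rr: "smooth_bdd (\<lambda>\<theta>. Im (poly p (rr \<theta>)))"
  unfolding smooth_bdd_def
  by (rule exI[of _ "\<lambda>n \<theta>. Im (poly ((theta_deriv ^^ n) p) (rr \<theta>))"])
    (auto intro: has_real_derivative_Im_poly_rr Im_poly_rr_bounded)

lemma abs_arctan_le_2: "\<bar>arctan x\<bar> \<le> 2"
  using arctan_bounded[of x] pi_less_4 by linarith

lemma smooth_bdd_arctan: "smooth_bdd arctan"
proof -
  define D where "D = (\<lambda>n \<theta>. if n = 0 then arctan \<theta> else Im (poly ((theta_deriv ^^ (n - 1)) [:0, \<i>:]) (rr \<theta>)))"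
  have "(D n has_real_derivative D (Suc n) x) (at x)" for n x
  proof (cases n)
    case 0
    then show ?thesis
      using DERIV_arctan[of x] by (simp add: D_def[abs_def] Re_rr inverse_eq_divide)
  next
    case (Suc m)
    then show ?thesis
      using has_real_derivative_Im_poly_rr[of "(theta_deriv ^^ m) [:0, \<i>:]" x] by (simp add: D_def[abs_def])
  qed
  moreover have "\<exists>C. \<forall>x. \<bar>D n x\<bar> \<le> C" for n
    using abs_arctan_le_2 Im_poly_rr_bounded by (cases "n = 0") (auto simp: D_def)
  moreover have "D 0 = arctan" by (simp add: D_def)
  ultimately show ?thesis unfolding smooth_bdd_def by blast
qed

lemma L_coeff_eq_poly:
  assumes "s \<ge> 1"
  obtains p where "\<And>\<theta>. L_coeff s \<theta> = Im (poly p (rr \<theta>))" "poly p 1 = 0"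
    "\<And>r. r \<noteq> 0 \<Longrightarrow> r \<noteq> 1 \<Longrightarrow> poly (theta_deriv p) r = \<i> * poly (riccati_coeff s) r / (1 - r)"
proof -
  obtain e where e: "[:0, 0, -1, 1:] * pderiv e = smult (-1 / 2) (Fpoly s)" "poly e 1 = 0"
    "\<And>\<theta>. E_minus s (- \<i> * of_real \<theta>) = poly e (rr \<theta>)"
    using E_minus_eq_poly[OF assms] by metis
  define p where "p = smult ((-1) ^ s) e"
  have sgn: "Im ((-1) ^ s * z) = (-1) ^ s * Im z" for z
    by (cases "even s") auto
  have "L_coeff s \<theta> = Im (poly p (rr \<theta>))" for \<theta>
    unfolding L_coeff_def e(3) by (simp add: p_def sgn)
  moreover have "poly (theta_deriv p) r = \<i> * poly (riccati_coeff s) r / (1 - r)" if "r \<noteq> 0" "r \<noteq> 1" for r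
  proof -
    have "poly (Fpoly s) r = - 2 * poly ([:0, 0, -1, 1:] * pderiv e) r"
      unfolding e by simp
    then have F: "poly (Fpoly s) r = 2 * (r\<^sup>2 * (1 - r) * poly (pderiv e) r)"
      by (simp add: algebra_simps power2_eq_square)
    have "poly (theta_deriv p) r = - \<i> * r\<^sup>2 * ((-1) ^ s * poly (pderiv e) r)"
      by (simp add: p_def theta_deriv_def pderiv_smult power2_eq_square)
    moreover have "poly (riccati_coeff s) r = - ((-1) ^ s) * (r\<^sup>2 * (1 - r) * poly (pderiv e) r)"
      using assms by (simp add: riccati_coeff_def F)
    ultimately show ?thesis using that by simp
  qed
  moreover have "poly p 1 = 0" using e(2) by (simp add: p_def)
  ultimately show ?thesis using that by blast
qed

lemma smooth_bdd_L_coeff: "s \<ge> 1 \<Longrightarrow> smooth_bdd (L_coeff s)"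
proof -
  assume "s \<ge> 1"
  then obtain p where "\<And>\<theta>. L_coeff s \<theta> = Im (poly p (rr \<theta>))"
    using L_coeff_eq_poly by metis
  then have "L_coeff s = (\<lambda>\<theta>. Im (poly p (rr \<theta>)))" by auto
  then show ?thesis using smooth_bdd_Im_poly_rr by simp
qed

definition trunc_phase :: "nat \<Rightarrow> real \<Rightarrow> real \<Rightarrow> real" where
  "trunc_phase K a \<theta> = a * \<theta> - arctan \<theta> + (\<Sum>s=1..K. L_coeff s \<theta> / a ^ s)"

lemma L_coeff_0: "s \<ge> 1 \<Longrightarrow> L_coeff s 0 = 0"
  using L_coeff_eq_poly[of s] by (metis rr_0 zero_complex.simps(2))

lemma trunc_phase_0: "trunc_phase K a 0 = 0"
  by (simp add: trunc_phase_def L_coeff_0)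

lemma leading_rate_split:
  assumes "\<theta> \<noteq> 0"
  shows "of_real a / (rr \<theta> * of_real \<theta>) = of_real (a / \<theta>) + \<i> * of_real a"
  using assms by (simp add: rr_def field_simps)

lemma inverse_rr_theta:
  assumes "\<theta> \<noteq> 0"
  shows "1 / (rr \<theta> * of_real \<theta>) = \<i> / (1 - rr \<theta>)"
  using assms unfolding i_theta_rr[symmetric] by simp

lemma has_real_derivative_L_coeff:
  assumes "s \<ge> 1" "\<theta> \<noteq> 0"
  shows "(L_coeff s has_real_derivative Im (poly (riccati_coeff s) (rr \<theta>) / (rr \<theta> * of_real \<theta>))) (at \<theta>)"
proof -
  obtain p where p: "\<And>\<theta>. L_coeff s \<theta> = Im (poly p (rr \<theta>))"
    "\<And>r. r \<noteq> 0 \<Longrightarrow> r \<noteq> 1 \<Longrightarrow> poly (theta_deriv p) r = \<i> * poly (riccati_coeff s) r / (1 - r)"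
    using L_coeff_eq_poly[OF assms(1)] by metis
  have "rr \<theta> \<noteq> 1" using i_theta_rr[of \<theta>] assms by auto
  then have "poly (theta_deriv p) (rr \<theta>) = poly (riccati_coeff s) (rr \<theta>) * (\<i> / (1 - rr \<theta>))"
    using p(2)[of "rr \<theta>"] by simp
  also have "\<dots> = poly (riccati_coeff s) (rr \<theta>) / (rr \<theta> * of_real \<theta>)"
    unfolding inverse_rr_theta[OF assms(2), symmetric] by simp
  finally show ?thesis
    using has_real_derivative_Im_poly_rr[of p \<theta>] by (simp add: p(1)[abs_def])
qed

text \<open>The derivative of the truncated phase is given by the same truncated series \<open>A\<close> that approximates \<open>1 / J\<close>:
  the terms \<open>a\<close>, \<open>- 1 / (1 + \<theta>\<^sup>2)\<close> and \<open>L\<^sub>s' / a^s\<close> are the contributions of the terms \<open>1\<close>, \<open>- F\<^sub>0 / a\<close> and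
  those with \<open>F\<^sub>s\<close>.\<close>

lemma has_real_derivative_trunc_phase:
  assumes "\<theta> \<noteq> 0" "a > 0"
  shows "(trunc_phase K a has_real_derivative Im (of_real a / (rr \<theta> * of_real \<theta>) * inv_amplitude K a \<theta>)) (at \<theta>)"
proof -
  let ?b = "\<lambda>s. poly (riccati_coeff s) (rr \<theta>) / (rr \<theta> * of_real \<theta>)"
  have "(trunc_phase K a has_real_derivative a - 1 / (1 + \<theta>\<^sup>2) + (\<Sum>s=1..K. Im (?b s) / a ^ s)) (at \<theta>)"
    unfolding trunc_phase_def[abs_def]
  proof (intro DERIV_add DERIV_diff DERIV_sum DERIV_cdivide has_real_derivative_L_coeff)
    show "((*) a has_real_derivative a) (at \<theta>)" by (auto intro!: derivative_eq_intros)
    show "(arctan has_real_derivative 1 / (1 + \<theta>\<^sup>2)) (at \<theta>)"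
      using DERIV_arctan[of \<theta>] by (simp add: inverse_eq_divide)
  qed (use assms in auto)
  moreover have "a - 1 / (1 + \<theta>\<^sup>2) + (\<Sum>s=1..K. Im (?b s) / a ^ s)
      = Im (of_real a / (rr \<theta> * of_real \<theta>) * inv_amplitude K a \<theta>)"
  proof -
    let ?t = "complex_of_real (1 / a)"
    have "of_real a / (rr \<theta> * of_real \<theta>) * inv_amplitude K a \<theta>
        = of_real a / (rr \<theta> * of_real \<theta>) + riccati_trunc K ?t (rr \<theta>) / (rr \<theta> * of_real \<theta>)"
      using assms by (simp add: inv_amplitude_def algebra_simps add_divide_distrib)
    also have "riccati_trunc K ?t (rr \<theta>) = poly (riccati_coeff 0) (rr \<theta>) + (\<Sum>s=1..K. ?t ^ s * poly (riccati_coeff s) (rr \<theta>))"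
      unfolding riccati_trunc_def by (simp add: sum.atLeast1_atMost_eq sum.atMost_shift)
    also have "(\<dots>) / (rr \<theta> * of_real \<theta>) = ?b 0 + (\<Sum>s=1..K. ?t ^ s * ?b s)"
      by (simp add: add_divide_distrib sum_divide_distrib)
    also have "?b 0 = - \<i> * rr \<theta>"
    proof -
      have "poly (riccati_coeff 0) (rr \<theta>) = - (rr \<theta> * (1 - rr \<theta>))"
        by (simp add: riccati_coeff_def algebra_simps)
      then show ?thesis
        using assms unfolding i_theta_rr[symmetric] by simp
    qed
    finally have "Im (of_real a / (rr \<theta> * of_real \<theta>) * inv_amplitude K a \<theta>)
        = Im (of_real a / (rr \<theta> * of_real \<theta>)) - Re (rr \<theta>) + (\<Sum>s=1..K. Im (?t ^ s * ?b s))"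
      by simp
    moreover have "Im (?t ^ s * z) = Im z / a ^ s" for s z
    proof -
      have "?t ^ s * z = of_real (1 / a ^ s) * z" by (simp add: power_divide)
      also have "Im \<dots> = Im z / a ^ s" by (simp del: of_real_divide of_real_power)
      finally show ?thesis .
    qed
    then have "(\<Sum>s=1..K. Im (?t ^ s * ?b s)) = (\<Sum>s=1..K. Im (?b s) / a ^ s)"
      by (simp only:)
    ultimately have "Im (of_real a / (rr \<theta> * of_real \<theta>) * inv_amplitude K a \<theta>)
        = Im (of_real a / (rr \<theta> * of_real \<theta>)) - Re (rr \<theta>) + (\<Sum>s=1..K. Im (?b s) / a ^ s)"
      by (simp only:)
    then show ?thesis unfolding leading_rate_split[OF assms(1)] Re_rr by simp
  qed
  ultimately show ?thesis by simp
qed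

lemma trunc_phase_derivative_lower_bound:
  "\<exists>a0. \<forall>a\<ge>a0. \<forall>\<theta>. \<exists>D\<ge>3 / 4 * a. (trunc_phase K a has_real_derivative D) (at \<theta>)"
proof -
  have "\<forall>s. \<exists>d C. s \<ge> 1 \<longrightarrow> (\<forall>x. (L_coeff s has_real_derivative d x) (at x) \<and> \<bar>d x\<bar> \<le> C)"
    using smooth_bdd_L_coeff unfolding smooth_bdd_def by metis
  then obtain d C where d: "\<And>s x. s \<ge> 1 \<Longrightarrow> (L_coeff s has_real_derivative d s x) (at x)"
    and C: "\<And>s x. s \<ge> 1 \<Longrightarrow> \<bar>d s x\<bar> \<le> C s"
    by metis
  show ?thesis
  proof (intro exI allI impI conjI)
    fix a \<theta> assume a: "a \<ge> max 1 (4 * (1 + (\<Sum>s=1..K. C s)))"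
    show "(trunc_phase K a has_real_derivative a - 1 / (1 + \<theta>\<^sup>2) + (\<Sum>s=1..K. d s \<theta> / a ^ s)) (at \<theta>)"
      unfolding trunc_phase_def[abs_def]
    proof (intro DERIV_add DERIV_diff DERIV_sum DERIV_cdivide d)
      show "((*) a has_real_derivative a) (at \<theta>)" by (auto intro!: derivative_eq_intros)
      show "(arctan has_real_derivative 1 / (1 + \<theta>\<^sup>2)) (at \<theta>)"
        using DERIV_arctan[of \<theta>] by (simp add: inverse_eq_divide)
    qed auto
    have "\<bar>d s \<theta> / a ^ s\<bar> \<le> C s" if "s \<ge> 1" for s
    proof -
      have "1 \<le> a ^ s" using a by (intro one_le_power) auto
      then have "\<bar>d s \<theta>\<bar> / a ^ s \<le> \<bar>d s \<theta>\<bar> / 1" by (intro divide_left_mono) auto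
      then show ?thesis using C[OF that, of \<theta>] a by (simp add: abs_divide)
    qed
    then have "\<bar>\<Sum>s=1..K. d s \<theta> / a ^ s\<bar> \<le> (\<Sum>s=1..K. C s)"
      by (intro order_trans[OF sum_abs] sum_mono) auto
    moreover have "1 / (1 + \<theta>\<^sup>2) \<le> 1" by (simp add: divide_le_eq_1 add_pos_nonneg)
    ultimately show "3 / 4 * a \<le> a - 1 / (1 + \<theta>\<^sup>2) + (\<Sum>s=1..K. d s \<theta> / a ^ s)"
      using a by (simp add: abs_le_iff)
  qed
qed

section \<open>The exact phase\<close>

definition amplitude :: "real \<Rightarrow> real \<Rightarrow> complex" where
  "amplitude a \<theta> = Si_complex a \<theta> * inverse (leading_term a \<theta>)"

lemma rr_polar: "rr \<theta> = of_real (norm (rr \<theta>)) * cis (- arctan \<theta>)"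
proof -
  have "norm (rr \<theta>) = 1 / sqrt (1 + \<theta>\<^sup>2)"
    using norm_rr_sq[of \<theta>] real_sqrt_unique[of "norm (rr \<theta>)" "1 / (1 + \<theta>\<^sup>2)"]
    by (simp add: real_sqrt_divide)
  moreover have "sqrt (1 + \<theta>\<^sup>2) * sqrt (1 + \<theta>\<^sup>2) = 1 + \<theta>\<^sup>2" by simp
  moreover have "Im (rr \<theta>) = - \<theta> / (1 + \<theta>\<^sup>2)"
    by (simp add: rr_def Im_divide power2_eq_square)
  ultimately show ?thesis
    by (simp add: complex_eq_iff Re_rr cos_arctan sin_arctan)
qed

text \<open>At 0 the amplitude is \<open>0 / 0\<close>, so the limit of the phase is prescribed there.\<close>

definition phase :: "real \<Rightarrow> real \<Rightarrow> real" where
  "phase a \<theta> = (if \<theta> = 0 then 0 else a * \<theta> - arctan \<theta> + Im (Ln (amplitude a \<theta>)))"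

lemma phase_0: "phase a 0 = 0"
  by (simp add: phase_def)

lemma Si_zero_iff_sin_phase:
  assumes a: "a > 1" and \<theta>: "\<theta> > 0" and J: "amplitude a \<theta> \<noteq> 0"
  shows "Si a (a * \<theta>) = 0 \<longleftrightarrow> sin (phase a \<theta>) = 0"
proof -
  have m: "norm (leading_term a \<theta>) > 0" using a \<theta> by (simp add: norm_leading_term)
  have "amplitude a \<theta> = exp (Ln (amplitude a \<theta>))" using J by simp
  also have "\<dots> = of_real (exp (Re (Ln (amplitude a \<theta>)))) * cis (Im (Ln (amplitude a \<theta>)))"
    by (simp add: exp_eq_polar)
  finally have Jp: "amplitude a \<theta> = of_real (exp (Re (Ln (amplitude a \<theta>)))) * cis (Im (Ln (amplitude a \<theta>)))" .
  define c where "c = (a * \<theta>) powr a / a * norm (rr \<theta>) * exp (Re (Ln (amplitude a \<theta>)))"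
  have c: "c > 0" using a \<theta> by (simp add: c_def)
  have "Si_complex a \<theta> = leading_term a \<theta> * amplitude a \<theta>" using m by (simp add: amplitude_def)
  also have "\<dots> = of_real c * (cis (a * \<theta>) * cis (- arctan \<theta>) * cis (Im (Ln (amplitude a \<theta>))))"
    by (subst Jp, unfold leading_term_def, subst rr_polar) (simp add: c_def mult_ac)
  also have "\<dots> = of_real c * cis (phase a \<theta>)"
    using \<theta> by (simp add: cis_mult phase_def)
  finally have "Im (Si_complex a \<theta>) = c * sin (phase a \<theta>)" by simp
  then show ?thesis using c Im_Si_complex[OF a, of \<theta>] by simp
qed

text \<open>The phase is an argument of \<open>H\<close>, so its derivative is \<open>Im (H' / H)\<close>, and \<open>H' = M * a / (r * \<theta>)\<close>.\<close>

lemma has_real_derivative_phase: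
  assumes a: "a > 1" and \<theta>: "\<theta> > 0" and J: "Re (amplitude a \<theta>) > 0"
  shows "(phase a has_real_derivative Im (of_real a / (rr \<theta> * of_real \<theta>) * inverse (amplitude a \<theta>))) (at \<theta>)"
proof -
  define P where "P = of_real a / (rr \<theta> * of_real \<theta>)"
  define M where "M = leading_term a \<theta>"
  define J where "J = amplitude a \<theta>"
  have M: "M \<noteq> 0" using a \<theta> norm_leading_term[of a \<theta>] by (auto simp: M_def)
  have J0: "J \<noteq> 0" using J by (auto simp: J_def)
  have "((\<lambda>\<theta>. inverse (leading_term a \<theta>)) has_vector_derivative
      (M * (P - \<i> * rr \<theta>)) * - (inverse M)\<^sup>2) (at \<theta>)"
    using field_vector_diff_chain_at[OF has_vector_derivative_leading_term[OF a \<theta>] DERIV_inverse[OF M[unfolded M_def]]]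
    unfolding M_def P_def o_def numeral_2_eq_2 .
  from has_vector_derivative_mult[OF has_vector_derivative_Si_complex[OF a \<theta>] this]
  have "(amplitude a has_vector_derivative
      Si_complex a \<theta> * ((M * (P - \<i> * rr \<theta>)) * - (inverse M)\<^sup>2) + M * P * inverse M) (at \<theta>)"
    unfolding M_def P_def amplitude_def[abs_def] .
  also have "Si_complex a \<theta> = M * J" using M by (simp add: M_def J_def amplitude_def)
  also have "M * J * ((M * (P - \<i> * rr \<theta>)) * - (inverse M)\<^sup>2) + M * P * inverse M = P - J * (P - \<i> * rr \<theta>)"
    using M by (simp add: field_simps power2_eq_square)
  finally have dJ: "(amplitude a has_vector_derivative P - J * (P - \<i> * rr \<theta>)) (at \<theta>)" .
  have "amplitude a \<theta> \<notin> \<real>\<^sub>\<le>\<^sub>0" using J by (auto simp: complex_nonpos_Reals_iff)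
  from field_vector_diff_chain_at[OF dJ has_field_derivative_Ln[OF this]]
  have "((\<lambda>\<theta>. Ln (amplitude a \<theta>)) has_vector_derivative (P - J * (P - \<i> * rr \<theta>)) * inverse J) (at \<theta>)"
    by (simp add: o_def J_def)
  also have "(P - J * (P - \<i> * rr \<theta>)) * inverse J = P * inverse J - P + \<i> * rr \<theta>"
    using J0 by (simp add: field_simps)
  finally have "((\<lambda>\<theta>. Im (Ln (amplitude a \<theta>))) has_real_derivative Im (P * inverse J - P + \<i> * rr \<theta>)) (at \<theta>)"
    unfolding has_real_derivative_iff_has_vector_derivative
    by (rule bounded_linear.has_vector_derivative[OF bounded_linear_Im])
  moreover have "((\<lambda>\<theta>. a * \<theta> - arctan \<theta>) has_real_derivative a - 1 / (1 + \<theta>\<^sup>2)) (at \<theta>)"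
    by (auto intro!: derivative_eq_intros simp: inverse_eq_divide)
  ultimately have "((\<lambda>\<theta>. a * \<theta> - arctan \<theta> + Im (Ln (amplitude a \<theta>))) has_real_derivative
      (a - 1 / (1 + \<theta>\<^sup>2)) + Im (P * inverse J - P + \<i> * rr \<theta>)) (at \<theta>)"
    by (intro DERIV_add)
  moreover have "(a - 1 / (1 + \<theta>\<^sup>2)) + Im (P * inverse J - P + \<i> * rr \<theta>) = Im (P * inverse J)"
  proof -
    have "Im P = a" using \<theta> leading_rate_split[of \<theta> a] by (simp add: P_def)
    then show ?thesis by (simp add: Re_rr)
  qed
  ultimately have "((\<lambda>\<theta>. a * \<theta> - arctan \<theta> + Im (Ln (amplitude a \<theta>))) has_real_derivative Im (P * inverse J)) (at \<theta>)"
    by (simp only:)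
  then have "(phase a has_real_derivative Im (P * inverse J)) (at \<theta>)"
    by (rule has_field_derivative_transform_within_open[where S = "{0<..}"]) (use \<theta> in \<open>auto simp: phase_def\<close>)
  then show ?thesis by (simp add: P_def J_def)
qed

lemma amplitude_approx:
  assumes "K \<ge> 1"
  shows "\<exists>C\<ge>0. \<exists>a0\<ge>6. \<forall>a\<ge>a0. (\<forall>\<theta>. norm (inv_amplitude K a \<theta> - 1) \<le> 1 / 4) \<and> (\<forall>\<theta>>0. norm (amplitude a \<theta> - 1) \<le> 2 / 3 \<and>
    norm (amplitude a \<theta> - inverse (inv_amplitude K a \<theta>)) \<le> C * (1 / a) ^ (K + 2) * \<theta> * norm (rr \<theta>) ^ 3)"
proof -
  obtain C where C: "C \<ge> 0" "\<And>t r. norm t \<le> 1 \<Longrightarrow> norm r \<le> 1 \<Longrightarrow>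
      norm (riccati_residual K t r) \<le> C * norm t ^ (K + 1) * norm (r - 1) * norm r ^ 3"
    using riccati_residual_bound[OF assms] by blast
  obtain B where B: "B \<ge> 0" "\<And>t r. norm t \<le> 1 \<Longrightarrow> norm r \<le> 1 \<Longrightarrow> norm (riccati_trunc K t r) \<le> B"
    using riccati_trunc_bounded[of K] by blast
  define a0 where "a0 = max 6 (max (4 * B) (24 * C))"
  show ?thesis
  proof (rule exI[of _ "8 * C"], intro conjI, use C in simp, rule exI[of _ a0], intro conjI allI impI)
    show "6 \<le> a0" by (simp add: a0_def)
    fix a assume "a \<ge> a0"
    then have a: "a \<ge> 6" "a \<ge> 4 * B" "a \<ge> 24 * C" by (auto simp: a0_def)
    have t: "norm (complex_of_real (1 / a)) = 1 / a" "norm (complex_of_real (1 / a)) \<le> 1"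
      using a by (simp_all add: norm_divide)
    show A: "norm (inv_amplitude K a \<theta> - 1) \<le> 1 / 4" for \<theta>
    proof -
      have "norm (inv_amplitude K a \<theta> - 1) = 1 / a * norm (riccati_trunc K (of_real (1 / a)) (rr \<theta>))"
        using a by (simp add: inv_amplitude_def norm_mult norm_divide)
      also have "\<dots> \<le> 1 / a * B"
        using a t by (intro mult_left_mono B norm_rr_le_1) auto
      also have "\<dots> \<le> 1 / 4" using a by (simp add: field_simps)
      finally show ?thesis .
    qed
    have A2: "norm (inv_amplitude K a \<theta>) \<ge> 3 / 4" for \<theta>
      using A[of \<theta>] norm_triangle_ineq2[of 1 "1 - inv_amplitude K a \<theta>"] by (simp add: norm_minus_commute)
    then have A3: "norm (inv_amplitude K a \<theta>) \<ge> 1 / 2" for \<theta> using A2[of \<theta>] by linarith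
    fix \<theta> :: real assume \<theta>: "\<theta> > 0"
    show J: "norm (amplitude a \<theta> - inverse (inv_amplitude K a \<theta>)) \<le> 8 * C * (1 / a) ^ (K + 2) * \<theta> * norm (rr \<theta>) ^ 3"
      unfolding amplitude_def divide_inverse[symmetric]
      by (rule Si_complex_ratio_approx[OF C(1) C(2)[OF t(2), unfolded t(1)] A3 a(1) \<theta>])
    have "8 * C * (1 / a) ^ (K + 2) * \<theta> * norm (rr \<theta>) ^ 3
        = 8 * C * (1 / a) ^ (K + 2) * ((\<theta> * norm (rr \<theta>)) * norm (rr \<theta>) ^ 2)"
      by (simp add: power2_eq_square power3_eq_cube)
    also have "\<dots> \<le> 8 * C * (1 / a) * (1 * 1)"
    proof (intro mult_mono mult_left_mono)
      show "(1 / a) ^ (K + 2) \<le> 1 / a"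
        using a power_decreasing[of 1 "K + 2" "1 / a"] by simp
      show "\<theta> * norm (rr \<theta>) \<le> 1" using theta_rr_le_1[of \<theta>] \<theta> by simp
      show "(norm (rr \<theta>))\<^sup>2 \<le> 1" using norm_rr_le_1[of \<theta>] by (simp add: power_le_one)
    qed (use C a \<theta> in auto)
    also have "\<dots> \<le> 1 / 3" using a by (simp add: field_simps)
    finally have "norm (amplitude a \<theta> - inverse (inv_amplitude K a \<theta>)) \<le> 1 / 3" using J by linarith
    moreover have "norm (inverse (inv_amplitude K a \<theta>) - 1) \<le> 1 / 3"
    proof -
      have nz: "norm (inv_amplitude K a \<theta>) > 0" using A2[of \<theta>] by linarith
      then have "inverse (inv_amplitude K a \<theta>) - 1 = (1 - inv_amplitude K a \<theta>) / inv_amplitude K a \<theta>"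
        by (simp add: field_simps)
      then have "norm (inverse (inv_amplitude K a \<theta>) - 1) = norm (inv_amplitude K a \<theta> - 1) / norm (inv_amplitude K a \<theta>)"
        by (simp add: norm_divide norm_minus_commute)
      then show ?thesis using A[of \<theta>] A2[of \<theta>] nz by (simp add: divide_le_eq)
    qed
    ultimately show "norm (amplitude a \<theta> - 1) \<le> 2 / 3"
      using norm_triangle_ineq[of "amplitude a \<theta> - inverse (inv_amplitude K a \<theta>)" "inverse (inv_amplitude K a \<theta>) - 1"] by simp
  qed
qed

lemma continuous_on_phase:
  assumes a: "a > 1" and J: "\<And>\<theta>. \<theta> > 0 \<Longrightarrow> norm (amplitude a \<theta> - 1) \<le> 2 / 3"
    and A: "\<And>\<theta>. \<theta> > 0 \<Longrightarrow> norm (amplitude a \<theta> - inverse (inv_amplitude K a \<theta>)) \<le> C * \<theta>"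
  shows "continuous_on {0..} (phase a)"
proof -
  have reJ: "Re (amplitude a \<theta>) > 0" if "\<theta> > 0" for \<theta>
    using J[OF that] abs_Re_le_cmod[of "amplitude a \<theta> - 1"] by simp
  have "continuous (at x within {0..}) (phase a)" if x: "x \<ge> 0" for x
  proof (cases "x = 0")
    case False
    then show ?thesis
      using x has_real_derivative_phase[OF a _ reJ, of x]
      by (auto intro: continuous_at_imp_continuous_at_within DERIV_isCont)
  next
    case True
    have ev: "\<forall>\<^sub>F \<theta> in at (0::real) within {0..}. \<theta> > 0"
      by (auto simp: eventually_at_filter)
    have A0: "inv_amplitude K a 0 = 1" by (simp add: inv_amplitude_def riccati_trunc_at_1)
    have "(inv_amplitude K a \<longlongrightarrow> inv_amplitude K a 0) (at 0 within {0..})"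
      using has_vector_derivative_continuous[OF has_vector_derivative_inv_amplitude] by (simp add: continuous_within)
    then have iA: "((\<lambda>\<theta>. inverse (inv_amplitude K a \<theta>)) \<longlongrightarrow> 1) (at 0 within {0..})"
      using tendsto_inverse[of "inv_amplitude K a" 1] A0 by simp
    have "((\<lambda>\<theta>. C * \<theta>) \<longlongrightarrow> 0) (at 0 within {0..})"
      by (auto intro!: tendsto_eq_intros)
    then have "((\<lambda>\<theta>. amplitude a \<theta> - inverse (inv_amplitude K a \<theta>)) \<longlongrightarrow> 0) (at 0 within {0..})"
      by (rule Lim_null_comparison[rotated]) (use ev in \<open>eventually_elim, auto intro: A\<close>)
    from tendsto_add[OF this iA] have "(amplitude a \<longlongrightarrow> 1) (at 0 within {0..})"
      by simp
    then have "((\<lambda>\<theta>. Im (Ln (amplitude a \<theta>))) \<longlongrightarrow> Im (Ln 1)) (at 0 within {0..})"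
      by (intro tendsto_Im tendsto_Ln) auto
    then have "((\<lambda>\<theta>. a * \<theta> - arctan \<theta> + Im (Ln (amplitude a \<theta>))) \<longlongrightarrow> a * 0 - arctan 0 + Im (Ln 1)) (at 0 within {0..})"
      by (intro tendsto_add tendsto_diff tendsto_mult tendsto_const tendsto_ident_at tendsto_arctan)
    moreover have "\<forall>\<^sub>F \<theta> in at 0 within {0..}. a * \<theta> - arctan \<theta> + Im (Ln (amplitude a \<theta>)) = phase a \<theta>"
      using ev by eventually_elim (simp add: phase_def)
    ultimately have "(phase a \<longlongrightarrow> 0) (at 0 within {0..})"
      using Lim_transform_eventually by fastforce
    then show ?thesis using True by (simp add: continuous_within phase_def)
  qed
  then show ?thesis by (simp add: continuous_on_eq_continuous_within)
qed

text \<open>The derivatives of the exact and the truncated phase differ by \<open>Im (a / (r * \<theta>) * (1 / J - A))\<close>, which is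
  \<open>O(a^(-K-1) * \<bar>r\<bar>\<^sup>2)\<close>. Since \<open>\<bar>r\<bar>\<^sup>2 = 1 / (1 + \<theta>\<^sup>2)\<close> is the derivative of \<open>arctan\<close>, which is bounded, the estimate integrates
  uniformly; both phases vanish at 0.\<close>

lemma phase_approx:
  assumes "K \<ge> 1"
  shows "\<exists>C\<ge>0. \<exists>a0>1. \<forall>a\<ge>a0. continuous_on {0..} (phase a)
    \<and> (\<forall>\<theta>>0. \<exists>d\<ge>a / 2. (phase a has_real_derivative d) (at \<theta>))
    \<and> (\<forall>\<theta>>0. Si a (a * \<theta>) = 0 \<longleftrightarrow> sin (phase a \<theta>) = 0)
    \<and> (\<forall>\<theta>>0. \<bar>phase a \<theta> - trunc_phase K a \<theta>\<bar> \<le> C * (1 / a) ^ (K + 1))"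
proof -
  obtain C a1 where C: "C \<ge> 0" and a1: "a1 \<ge> 6"
    and A: "\<And>a \<theta>. a \<ge> a1 \<Longrightarrow> norm (inv_amplitude K a \<theta> - 1) \<le> 1 / 4"
    and J: "\<And>a \<theta>. a \<ge> a1 \<Longrightarrow> \<theta> > 0 \<Longrightarrow> norm (amplitude a \<theta> - 1) \<le> 2 / 3"
    and JA: "\<And>a \<theta>. a \<ge> a1 \<Longrightarrow> \<theta> > 0 \<Longrightarrow>
      norm (amplitude a \<theta> - inverse (inv_amplitude K a \<theta>)) \<le> C * (1 / a) ^ (K + 2) * \<theta> * norm (rr \<theta>) ^ 3"
    using amplitude_approx[OF assms] by metis
  obtain a2 where a2: "\<And>a \<theta>. a \<ge> a2 \<Longrightarrow> \<exists>D\<ge>3 / 4 * a. (trunc_phase K a has_real_derivative D) (at \<theta>)"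
    using trunc_phase_derivative_lower_bound[of K] by blast
  define C' where "C' = 4 * C"
  define a0 where "a0 = max a1 (max a2 (4 * C'))"
  have C': "C' \<ge> 0" using C by (simp add: C'_def)
  show ?thesis
  proof (rule exI[of _ "2 * C'"], intro conjI, use C' in simp, rule exI[of _ a0], intro conjI allI impI)
    show "1 < a0" using a1 by (simp add: a0_def)
    fix a assume "a \<ge> a0"
    then have a: "a \<ge> a1" "a \<ge> a2" "a \<ge> 4 * C'" "a \<ge> 6" "a > 1" using a1 by (auto simp: a0_def)
    have reJ: "Re (amplitude a \<theta>) > 0" if "\<theta> > 0" for \<theta>
      using J[OF a(1) that] abs_Re_le_cmod[of "amplitude a \<theta> - 1"] by simp
    then have J0: "amplitude a \<theta> \<noteq> 0" if "\<theta> > 0" for \<theta> using that by force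
    show cont: "continuous_on {0..} (phase a)"
    proof (rule continuous_on_phase[OF a(5) J[OF a(1)]])
      fix \<theta> :: real assume \<theta>: "\<theta> > 0"
      have "norm (rr \<theta>) ^ 3 \<le> 1" by (intro power_le_one norm_rr_le_1) auto
      then have "C * (1 / a) ^ (K + 2) * \<theta> * norm (rr \<theta>) ^ 3 \<le> C * (1 / a) ^ (K + 2) * \<theta> * 1"
        using C a \<theta> by (intro mult_left_mono) auto
      then show "norm (amplitude a \<theta> - inverse (inv_amplitude K a \<theta>)) \<le> C * (1 / a) ^ (K + 2) * \<theta>"
        using JA[OF a(1) \<theta>] by linarith
    qed
    define d where "d = (\<lambda>\<theta>. Im (of_real a / (rr \<theta> * of_real \<theta>) * inverse (amplitude a \<theta>)))"
    define e where "e = (\<lambda>\<theta>. Im (of_real a / (rr \<theta> * of_real \<theta>) * inv_amplitude K a \<theta>))"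
    have dd: "(phase a has_real_derivative d \<theta>) (at \<theta>)" if "\<theta> > 0" for \<theta>
      unfolding d_def using a that by (intro has_real_derivative_phase reJ) auto
    have de: "(trunc_phase K a has_real_derivative e \<theta>) (at \<theta>)" if "\<theta> > 0" for \<theta>
      unfolding e_def using a that by (intro has_real_derivative_trunc_phase) auto
    have diff: "\<bar>d \<theta> - e \<theta>\<bar> \<le> C' * (1 / a) ^ (K + 1) * (1 / (1 + \<theta>\<^sup>2))" if \<theta>: "\<theta> > 0" for \<theta>
    proof -
      let ?P = "of_real a / (rr \<theta> * of_real \<theta>)" and ?J = "amplitude a \<theta>" and ?A = "inv_amplitude K a \<theta>"
      have nA: "norm ?A \<ge> 3 / 4" "norm ?A \<le> 5 / 4"
        using A[OF a(1), of \<theta>] norm_triangle_ineq2[of 1 "1 - ?A"] norm_triangle_ineq[of "?A - 1" 1]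
        by (simp_all add: norm_minus_commute)
      have nJ: "norm ?J \<ge> 1 / 3"
        using J[OF a(1) \<theta>] norm_triangle_ineq2[of 1 "1 - ?J"] by (simp add: norm_minus_commute)
      have nz: "?A \<noteq> 0" "?J \<noteq> 0" using nA nJ by auto
      have "d \<theta> - e \<theta> = Im (?P * (inverse ?J - ?A))" by (simp add: d_def e_def right_diff_distrib)
      then have "\<bar>d \<theta> - e \<theta>\<bar> \<le> norm (?P * (inverse ?J - ?A))" using abs_Im_le_cmod by metis
      also have "inverse ?J - ?A = ?A * (inverse ?A - ?J) * inverse ?J"
        using nz by (simp add: field_simps)
      also have "norm (?P * (?A * (inverse ?A - ?J) * inverse ?J))
          = a / (norm (rr \<theta>) * \<theta>) * (norm ?A * norm (?J - inverse ?A) * inverse (norm ?J))"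
        using a \<theta> by (simp add: norm_mult norm_divide norm_inverse norm_minus_commute)
      also have "\<dots> \<le> a / (norm (rr \<theta>) * \<theta>) * (5 / 4 * (C * (1 / a) ^ (K + 2) * \<theta> * norm (rr \<theta>) ^ 3) * 3)"
      proof (intro mult_left_mono mult_mono)
        have "inverse (norm ?J) \<le> inverse (1 / 3)" using nJ by (intro le_imp_inverse_le) auto
        then show "inverse (norm ?J) \<le> 3" by simp
      qed (use nA JA[OF a(1) \<theta>] a \<theta> C in auto)
      also have "\<dots> = 15 / 4 * C * (1 / a) ^ (K + 1) * (norm (rr \<theta>))\<^sup>2"
      proof -
        have "a / (n * \<theta>) * (5 / 4 * (C * (1 / a * x) * \<theta> * (n * m)) * 3) = 15 / 4 * C * x * m"
          if "n \<noteq> 0" for x n m :: real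
          using that a \<theta> by simp
        from this[of "norm (rr \<theta>)" "(1 / a) ^ (K + 1)" "(norm (rr \<theta>))\<^sup>2"] show ?thesis
          by (simp add: power2_eq_square power3_eq_cube)
      qed
      also have "\<dots> \<le> C' * (1 / a) ^ (K + 1) * (norm (rr \<theta>))\<^sup>2"
        unfolding C'_def using C a by (intro mult_right_mono) auto
      finally show ?thesis by (simp only: norm_rr_sq)
    qed
    have C1: "C' * (1 / a) ^ (K + 1) \<ge> 0" using C' a by simp
    fix \<theta> :: real assume \<theta>: "\<theta> > 0"
    show "Si a (a * \<theta>) = 0 \<longleftrightarrow> sin (phase a \<theta>) = 0"
      using a \<theta> J0 by (intro Si_zero_iff_sin_phase) auto
    show "\<exists>d\<ge>a / 2. (phase a has_real_derivative d) (at \<theta>)"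
    proof (rule exI[of _ "d \<theta>"], intro conjI dd \<theta>)
      obtain D where D: "D \<ge> 3 / 4 * a" "(trunc_phase K a has_real_derivative D) (at \<theta>)"
        using a2[OF a(2)] by blast
      have "e \<theta> = D" using DERIV_unique[OF de[OF \<theta>] D(2)] .
      moreover have "C' * (1 / a) ^ (K + 1) * (1 / (1 + \<theta>\<^sup>2)) \<le> C' * 1 * 1"
        using a C' by (intro mult_mono power_le_one) (auto simp: divide_le_eq_1 add_pos_nonneg)
      ultimately show "a / 2 \<le> d \<theta>"
        using diff[OF \<theta>] D(1) a(3) by (simp add: abs_le_iff)
    qed
    have "norm ((phase a \<theta> - trunc_phase K a \<theta>) - (phase a 0 - trunc_phase K a 0))
        \<le> C' * (1 / a) ^ (K + 1) * arctan \<theta> - C' * (1 / a) ^ (K + 1) * arctan 0"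
    proof (rule differentiable_bound_general[OF \<theta>])
      have "continuous_on {0..\<theta>} (phase a)" using cont by (rule continuous_on_subset) auto
      moreover have "continuous_on {0..\<theta>} (trunc_phase K a)"
        using a2[OF a(2)] DERIV_isCont by (auto intro!: continuous_at_imp_continuous_on)
      ultimately show "continuous_on {0..\<theta>} (\<lambda>\<theta>. phase a \<theta> - trunc_phase K a \<theta>)"
        by (intro continuous_on_diff)
      show "continuous_on {0..\<theta>} (\<lambda>\<theta>. C' * (1 / a) ^ (K + 1) * arctan \<theta>)"
        by (intro continuous_intros)
      fix x assume x: "0 < x" "x < \<theta>"
      show "((\<lambda>\<theta>. phase a \<theta> - trunc_phase K a \<theta>) has_vector_derivative d x - e x) (at x)"
        using dd[of x] de[of x] x by (intro has_vector_derivative_diff)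
          (auto simp flip: has_real_derivative_iff_has_vector_derivative)
      have "((\<lambda>\<theta>. C' * (1 / a) ^ (K + 1) * arctan \<theta>) has_real_derivative C' * (1 / a) ^ (K + 1) * (1 / (1 + x\<^sup>2))) (at x)"
        using DERIV_cmult[OF DERIV_arctan[of x]] by (simp only: inverse_eq_divide)
      then show "((\<lambda>\<theta>. C' * (1 / a) ^ (K + 1) * arctan \<theta>) has_vector_derivative C' * (1 / a) ^ (K + 1) * (1 / (1 + x\<^sup>2))) (at x)"
        by (simp add: has_real_derivative_iff_has_vector_derivative)
      show "norm (d x - e x) \<le> C' * (1 / a) ^ (K + 1) * (1 / (1 + x\<^sup>2))"
        using diff[OF x(1)] by simp
    qed
    also have "\<dots> \<le> C' * (1 / a) ^ (K + 1) * 2"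
      using abs_arctan_le_2[of \<theta>] C1 by (simp del: power_Suc add: mult_left_mono)
    finally show "\<bar>phase a \<theta> - trunc_phase K a \<theta>\<bar> \<le> 2 * C' * (1 / a) ^ (K + 1)"
      by (simp add: trunc_phase_0 phase_0 mult_ac)
  qed
qed

section \<open>Zeros\<close>

lemma mean_value_lower_bound:
  fixes f :: "real \<Rightarrow> real"
  assumes "x < y" "continuous_on {x..y} f"
    and "\<And>z. x < z \<Longrightarrow> z < y \<Longrightarrow> \<exists>d\<ge>c. (f has_real_derivative d) (at z)"
  shows "c * (y - x) \<le> f y - f x"
proof -
  obtain l z where z: "x < z" "z < y" "(f has_real_derivative l) (at z)" "f y - f x = (y - x) * l"
    using MVT[OF assms(1,2)] assms(3) real_differentiable_def by blast
  obtain d where "d \<ge> c" "(f has_real_derivative d) (at z)" using assms(3) z by blast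
  then have "c \<le> l" using DERIV_unique z(3) by blast
  then show ?thesis using z(4) assms(1) by (simp add: mult.commute mult_right_mono)
qed

text \<open>The phase increases strictly from 0 to infinity, so it takes each value \<open>n * \<pi>\<close>, \<open>n \<ge> 1\<close>, exactly once, and
  these points enumerate the zeros in increasing order.\<close>

lemma Si_zero_properties:
  assumes a: "a > 0" and cont: "continuous_on {0..} (phase a)"
    and d: "\<And>\<theta>. \<theta> > 0 \<Longrightarrow> \<exists>d\<ge>a / 2. (phase a has_real_derivative d) (at \<theta>)"
    and Si: "\<And>\<theta>. \<theta> > 0 \<Longrightarrow> Si a (a * \<theta>) = 0 \<longleftrightarrow> sin (phase a \<theta>) = 0"
    and m: "m \<ge> 1"
  shows "Si_zero m a > 0" "phase a (Si_zero m a) = real m * pi"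
proof -
  have incr: "a / 2 * (y - x) \<le> phase a y - phase a x" if "0 \<le> x" "x < y" for x y
    using that by (intro mean_value_lower_bound d continuous_on_subset[OF cont]) auto
  have mono: "phase a x < phase a y" if "0 \<le> x" "x < y" for x y
  proof -
    have "0 < a / 2 * (y - x)" using a that by simp
    then show ?thesis using incr[OF that] by linarith
  qed
  have inj: "x = y" if "phase a x = phase a y" "0 \<le> x" "0 \<le> y" for x y
    using mono[of x y] mono[of y x] that by force
  have "\<exists>\<theta>>0. phase a \<theta> = real n * pi" if "n \<ge> 1" for n
  proof -
    let ?b = "2 * real n * pi / a"
    have b: "?b > 0" using a that by simp
    have "real n * pi \<le> phase a ?b"
      using incr[OF order_refl b] a by (simp add: phase_0)
    moreover have "continuous_on {0..?b} (phase a)" by (rule continuous_on_subset[OF cont]) auto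
    ultimately obtain \<theta> where \<theta>: "0 \<le> \<theta>" "phase a \<theta> = real n * pi"
      using IVT'[of "phase a" 0 "real n * pi" ?b] b by (auto simp: phase_0)
    then show ?thesis using that phase_0[of a] by (intro exI[of _ \<theta>]) (cases "\<theta> = 0", auto)
  qed
  then obtain g where g: "\<And>n. n \<ge> 1 \<Longrightarrow> g n > 0" "\<And>n. n \<ge> 1 \<Longrightarrow> phase a (g n) = real n * pi"
    by metis
  have zeros: "0 < \<theta> \<and> Si a (a * \<theta>) = 0 \<longleftrightarrow> (\<exists>n\<ge>1. \<theta> = g n)" for \<theta>
  proof
    assume \<theta>: "0 < \<theta> \<and> Si a (a * \<theta>) = 0"
    then obtain i :: int where i: "phase a \<theta> = of_int i * pi"
      using Si[of \<theta>] by (auto simp: sin_zero_iff_int2)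
    have "phase a \<theta> > 0" using mono[of 0 \<theta>] \<theta> by (simp add: phase_0)
    then have "i > 0" using i by (simp add: zero_less_mult_iff)
    then have "nat i \<ge> 1" "phase a \<theta> = phase a (g (nat i))"
      using i g(2)[of "nat i"] by auto
    then show "\<exists>n\<ge>1. \<theta> = g n" using inj \<theta> g(1) by (metis less_imp_le)
  next
    assume "\<exists>n\<ge>1. \<theta> = g n"
    then show "0 < \<theta> \<and> Si a (a * \<theta>) = 0" using g Si by auto
  qed
  have g_le: "g i \<le> g n \<longleftrightarrow> i \<le> n" if "i \<ge> 1" "n \<ge> 1" for i n
  proof -
    have "g i \<le> g n \<longleftrightarrow> phase a (g i) \<le> phase a (g n)"
      using mono[of "g i" "g n"] mono[of "g n" "g i"] g(1)[OF that(1)] g(1)[OF that(2)] by force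
    also have "\<dots> \<longleftrightarrow> real i * pi \<le> real n * pi" using g(2) that by simp
    finally show ?thesis by simp
  qed
  have card: "card {t. 0 < t \<and> t \<le> g n \<and> Si a (a * t) = 0} = n" if "n \<ge> 1" for n
  proof -
    have "{t. 0 < t \<and> t \<le> g n \<and> Si a (a * t) = 0} = g ` {1..n}"
    proof (intro set_eqI iffI)
      fix t assume "t \<in> {t. 0 < t \<and> t \<le> g n \<and> Si a (a * t) = 0}"
      then have t: "t \<le> g n" "0 < t \<and> Si a (a * t) = 0" by auto
      from t(2) obtain i where "i \<ge> 1" "t = g i" using zeros by blast
      then show "t \<in> g ` {1..n}" using g_le[of i n] t that by auto
    next
      fix t assume "t \<in> g ` {1..n}"
      then obtain i where i: "i \<ge> 1" "i \<le> n" "t = g i" by auto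
      then show "t \<in> {t. 0 < t \<and> t \<le> g n \<and> Si a (a * t) = 0}"
        using zeros[of t] g_le[of i n] that by blast
    qed
    moreover have "inj_on g {1..n}"
      using g_le by (intro inj_onI) (metis antisym atLeastAtMost_iff order_refl)
    ultimately show ?thesis by (simp add: card_image)
  qed
  have "Si_zero m a = g m"
    unfolding Si_zero_def
  proof (rule the_equality)
    show "0 < g m \<and> Si a (a * g m) = 0 \<and> card {t. 0 < t \<and> t \<le> g m \<and> Si a (a * t) = 0} = m"
      using zeros[of "g m"] card m by auto
    fix \<theta> assume \<theta>: "0 < \<theta> \<and> Si a (a * \<theta>) = 0 \<and> card {t. 0 < t \<and> t \<le> \<theta> \<and> Si a (a * t) = 0} = m"
    then obtain n where "n \<ge> 1" "\<theta> = g n" using zeros by blast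
    then show "\<theta> = g m" using card[of n] \<theta> by simp
  qed
  then show "Si_zero m a > 0" "phase a (Si_zero m a) = real m * pi" using g m by auto
qed

lemma Si_zero0_eq:
  assumes a: "a > 1" and m: "m \<ge> 1"
  shows "a * Si_zero0 m a - arctan (Si_zero0 m a) = real m * pi"
proof -
  define f where "f = (\<lambda>x. a * x - arctan x)"
  have f': "\<exists>d\<ge>a - 1. (f has_real_derivative d) (at z)" for z
  proof (intro exI conjI)
    show "(f has_real_derivative a - 1 / (1 + z\<^sup>2)) (at z)"
      unfolding f_def by (auto intro!: derivative_eq_intros simp: inverse_eq_divide)
    show "a - 1 \<le> a - 1 / (1 + z\<^sup>2)" by (simp add: divide_le_eq_1 add_pos_nonneg)
  qed
  have cont: "continuous_on S f" for S
    unfolding f_def by (intro continuous_intros)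
  have mono: "f x < f y" if "x < y" for x y
  proof -
    have "0 < (a - 1) * (y - x)" using a that by simp
    then show ?thesis using mean_value_lower_bound[OF that cont f'] by linarith
  qed
  let ?b = "(real m * pi + 2) / a"
  have "real m * pi \<le> f ?b" using abs_arctan_le_2[of ?b] a by (simp add: f_def)
  moreover have "0 \<le> ?b" using a by simp
  ultimately obtain x where x: "0 \<le> x" "f x = real m * pi"
    using IVT'[of f 0 "real m * pi" ?b] cont by (auto simp: f_def)
  then have "x > 0" using m by (cases "x = 0") (auto simp: f_def)
  have "Si_zero0 m a = x"
    unfolding Si_zero0_def f_def[symmetric]
  proof (rule the_equality)
    show "0 < x \<and> a * x - arctan x = real m * pi" using x \<open>x > 0\<close> by (simp add: f_def)
    fix y assume "0 < y \<and> a * y - arctan y = real m * pi"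
    then have "f y = f x" using x by (simp add: f_def)
    then show "y = x" using mono[of x y] mono[of y x] by force
  qed
  then show ?thesis using x by (simp add: f_def)
qed

section \<open>Uniform expansions in powers of \<open>1 / a\<close>\<close>

definition bounded_fun :: "(real \<Rightarrow> real) \<Rightarrow> bool" where
  "bounded_fun c \<longleftrightarrow> (\<exists>C\<ge>0. \<forall>x. \<bar>c x\<bar> \<le> C)"

lemma bounded_funI: "(\<And>x. \<bar>c x\<bar> \<le> C) \<Longrightarrow> bounded_fun c"
  unfolding bounded_fun_def by (meson abs_ge_zero order_trans)

lemma bounded_fun_const: "bounded_fun (\<lambda>x. k)"
  by (rule bounded_funI[of _ "\<bar>k\<bar>"]) simp

lemma bounded_fun_add: "bounded_fun c \<Longrightarrow> bounded_fun d \<Longrightarrow> bounded_fun (\<lambda>x. c x + d x)"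
  unfolding bounded_fun_def by (metis abs_triangle_ineq add_mono add_nonneg_nonneg order_trans)

lemma bounded_fun_mult: 
  assumes "bounded_fun c" "bounded_fun d" shows "bounded_fun (\<lambda>x. c x * d x)"
proof -
  obtain C D where "C \<ge> 0" "\<And>x. \<bar>c x\<bar> \<le> C" "D \<ge> 0" "\<And>x. \<bar>d x\<bar> \<le> D"
    using assms unfolding bounded_fun_def by blast
  then show ?thesis by (intro bounded_funI[of _ "C * D"]) (simp add: abs_mult mult_mono)
qed

lemma bounded_fun_minus: "bounded_fun c \<Longrightarrow> bounded_fun (\<lambda>x. - c x)"
  by (simp add: bounded_fun_def)

lemma bounded_fun_diff: "bounded_fun c \<Longrightarrow> bounded_fun d \<Longrightarrow> bounded_fun (\<lambda>x. c x - d x)"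
  using bounded_fun_add[of c "\<lambda>x. - d x"] bounded_fun_minus[of d] by simp

lemma bounded_fun_sum: "(\<And>i. i \<in> I \<Longrightarrow> bounded_fun (c i)) \<Longrightarrow> bounded_fun (\<lambda>x. \<Sum>i\<in>I. c i x)"
  by (induction I rule: infinite_finite_induct) (auto intro: bounded_fun_const bounded_fun_add)

text \<open>An asymptotic expansion to order \<open>M\<close> in the parameter \<open>t = 1 / a\<close>, uniform in \<open>x\<close>. The coefficients are packaged
  as a formal power series for each \<open>x\<close>; only those up to degree \<open>M\<close> matter.\<close>

definition uniform_exp :: "nat \<Rightarrow> (real \<Rightarrow> real \<Rightarrow> real) \<Rightarrow> (real \<Rightarrow> real fps) \<Rightarrow> bool" where
  "uniform_exp M g G \<longleftrightarrow> (\<forall>n\<le>M. bounded_fun (\<lambda>x. fps_nth (G x) n)) \<and>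
     (\<exists>C\<ge>0. \<forall>x t. 0 < t \<longrightarrow> t \<le> 1 \<longrightarrow> \<bar>g x t - (\<Sum>n\<le>M. fps_nth (G x) n * t ^ n)\<bar> \<le> C * t ^ (M + 1))"

lemma uniform_exp_coeff: "uniform_exp M g G \<Longrightarrow> n \<le> M \<Longrightarrow> bounded_fun (\<lambda>x. fps_nth (G x) n)"
  by (simp add: uniform_exp_def)

lemma uniform_exp_remainder:
  assumes "uniform_exp M g G"
  obtains C where "C \<ge> 0"
    "\<And>x t. 0 < t \<Longrightarrow> t \<le> 1 \<Longrightarrow> \<bar>g x t - (\<Sum>n\<le>M. fps_nth (G x) n * t ^ n)\<bar> \<le> C * t ^ (M + 1)"
  using assms unfolding uniform_exp_def by blast

lemma uniform_expI:
  assumes "\<And>n. n \<le> M \<Longrightarrow> bounded_fun (\<lambda>x. fps_nth (G x) n)"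
    and "\<And>x t. 0 < t \<Longrightarrow> t \<le> 1 \<Longrightarrow> \<bar>g x t - (\<Sum>n\<le>M. fps_nth (G x) n * t ^ n)\<bar> \<le> C * t ^ (M + 1)"
  shows "uniform_exp M g G"
  unfolding uniform_exp_def
proof (intro conjI allI impI exI[of _ "\<bar>C\<bar>"])
  fix x t :: real assume t: "0 < t" "t \<le> 1"
  have "C * t ^ (M + 1) \<le> \<bar>C\<bar> * t ^ (M + 1)" using t by (intro mult_right_mono) auto
  then show "\<bar>g x t - (\<Sum>n\<le>M. fps_nth (G x) n * t ^ n)\<bar> \<le> \<bar>C\<bar> * t ^ (M + 1)"
    using assms(2)[OF t, of x] by linarith
qed (use assms in auto)

lemma uniform_exp_cong:
  assumes "uniform_exp M g G" "\<And>x n. n \<le> M \<Longrightarrow> fps_nth (G' x) n = fps_nth (G x) n"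
  shows "uniform_exp M g G'"
proof -
  have "(\<Sum>n\<le>M. fps_nth (G' x) n * t ^ n) = (\<Sum>n\<le>M. fps_nth (G x) n * t ^ n)" for x t
    using assms(2) by (intro sum.cong) auto
  moreover have "bounded_fun (\<lambda>x. fps_nth (G' x) n)" if "n \<le> M" for n
    using uniform_exp_coeff[OF assms(1) that] assms(2)[OF that] by simp
  ultimately show ?thesis
    using assms(1) unfolding uniform_exp_def by simp
qed

lemma uniform_exp_perturb:
  assumes "uniform_exp M g G" "\<And>x t. 0 < t \<Longrightarrow> t \<le> 1 \<Longrightarrow> \<bar>g' x t - g x t\<bar> \<le> D * t ^ (M + 1)"
  shows "uniform_exp M g' G"
proof -
  obtain C where C: "\<And>x t. 0 < t \<Longrightarrow> t \<le> 1 \<Longrightarrow>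
      \<bar>g x t - (\<Sum>n\<le>M. fps_nth (G x) n * t ^ n)\<bar> \<le> C * t ^ (M + 1)"
    using uniform_exp_remainder[OF assms(1)] by metis
  show ?thesis
  proof (rule uniform_expI[of _ _ _ "C + D"])
    fix x t :: real assume t: "0 < t" "t \<le> 1"
    show "\<bar>g' x t - (\<Sum>n\<le>M. fps_nth (G x) n * t ^ n)\<bar> \<le> (C + D) * t ^ (M + 1)"
      using C[OF t, of x] assms(2)[OF t, of x] by (simp only: distrib_right)
  qed (rule uniform_exp_coeff[OF assms(1)])
qed

lemma uniform_exp_poly: 
  assumes "\<And>n. n \<le> M \<Longrightarrow> bounded_fun (\<lambda>x. fps_nth (G x) n)"
  shows "uniform_exp M (\<lambda>x t. \<Sum>n\<le>M. fps_nth (G x) n * t ^ n) G"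
  by (rule uniform_expI[of _ _ _ 0]) (use assms in auto)

lemma uniform_exp_const:
  assumes "bounded_fun c"
  shows "uniform_exp M (\<lambda>x t. c x) (\<lambda>x. fps_const (c x))"
proof -
  have "(\<Sum>n\<le>M. fps_nth (fps_const (c x)) n * t ^ n) = c x" for x t
  proof -
    have "(\<Sum>n\<le>M. fps_nth (fps_const (c x)) n * t ^ n) = (\<Sum>n\<le>M. if n = 0 then c x else 0)"
      by (intro sum.cong) auto
    then show ?thesis by simp
  qed
  moreover have "bounded_fun (\<lambda>x. fps_nth (fps_const (c x)) n)" for n
    using assms by (cases "n = 0") (auto intro: bounded_fun_const)
  ultimately show ?thesis using uniform_exp_poly[of M "\<lambda>x. fps_const (c x)"] by simp
qed

lemma uniform_exp_X_power: "uniform_exp M (\<lambda>x t. t ^ k) (\<lambda>x. fps_X ^ k)"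
proof (rule uniform_expI[of _ _ _ 1])
  fix x t :: real assume t: "0 < t" "t \<le> 1"
  have *: "(\<Sum>n\<le>M. fps_nth (fps_X ^ k :: real fps) n * t ^ n) = (if k \<le> M then t ^ k else 0)"
  proof -
    have "(\<Sum>n\<le>M. fps_nth (fps_X ^ k :: real fps) n * t ^ n) = (\<Sum>n\<le>M. if n = k then t ^ k else 0)"
      by (intro sum.cong) (auto simp: fps_X_power_nth)
    then show ?thesis by simp
  qed
  show "\<bar>t ^ k - (\<Sum>n\<le>M. fps_nth (fps_X ^ k) n * t ^ n)\<bar> \<le> 1 * t ^ (M + 1)"
    unfolding * using t by (auto intro!: power_decreasing simp del: power_Suc)
qed (auto intro: bounded_fun_const)

lemma uniform_exp_add:
  assumes "uniform_exp M g G" "uniform_exp M h H"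
  shows "uniform_exp M (\<lambda>x t. g x t + h x t) (\<lambda>x. G x + H x)"
proof -
  obtain C where C: "\<And>x t. 0 < t \<Longrightarrow> t \<le> 1 \<Longrightarrow>
      \<bar>g x t - (\<Sum>n\<le>M. fps_nth (G x) n * t ^ n)\<bar> \<le> C * t ^ (M + 1)"
    using uniform_exp_remainder[OF assms(1)] by metis
  obtain D where D: "\<And>x t. 0 < t \<Longrightarrow> t \<le> 1 \<Longrightarrow>
      \<bar>h x t - (\<Sum>n\<le>M. fps_nth (H x) n * t ^ n)\<bar> \<le> D * t ^ (M + 1)"
    using uniform_exp_remainder[OF assms(2)] by metis
  show ?thesis
  proof (rule uniform_expI[of _ _ _ "C + D"])
    fix x t :: real assume t: "0 < t" "t \<le> 1"
    have "(\<Sum>n\<le>M. fps_nth (G x + H x) n * t ^ n)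
        = (\<Sum>n\<le>M. fps_nth (G x) n * t ^ n) + (\<Sum>n\<le>M. fps_nth (H x) n * t ^ n)"
      by (simp add: distrib_right sum.distrib)
    then show "\<bar>g x t + h x t - (\<Sum>n\<le>M. fps_nth (G x + H x) n * t ^ n)\<bar> \<le> (C + D) * t ^ (M + 1)"
      using C[OF t, of x] D[OF t, of x] unfolding distrib_right by linarith
  qed (use assms in \<open>auto intro: bounded_fun_add uniform_exp_coeff\<close>)
qed

lemma bounded_fun_obtain:
  assumes "\<And>n. n \<le> M \<Longrightarrow> bounded_fun (\<lambda>x. c x n)"
  obtains C where "\<And>n. n \<le> M \<Longrightarrow> C n \<ge> 0" "\<And>n x. n \<le> (M :: nat) \<Longrightarrow> \<bar>c x n\<bar> \<le> C n"
  using assms unfolding bounded_fun_def by metis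

lemma uniform_exp_bounded:
  assumes "uniform_exp M g G"
  obtains B where "B \<ge> 0" "\<And>x t. 0 < t \<Longrightarrow> t \<le> 1 \<Longrightarrow> \<bar>g x t\<bar> \<le> B"
proof -
  obtain C where C: "C \<ge> 0" "\<And>x t. 0 < t \<Longrightarrow> t \<le> 1 \<Longrightarrow>
      \<bar>g x t - (\<Sum>n\<le>M. fps_nth (G x) n * t ^ n)\<bar> \<le> C * t ^ (M + 1)"
    using uniform_exp_remainder[OF assms] by metis
  obtain A where A: "\<And>n. n \<le> M \<Longrightarrow> A n \<ge> 0" "\<And>n x. n \<le> M \<Longrightarrow> \<bar>fps_nth (G x) n\<bar> \<le> A n"
    using bounded_fun_obtain[of M "\<lambda>x. fps_nth (G x)"] uniform_exp_coeff[OF assms] by metis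
  show ?thesis
  proof (rule that[of "C + (\<Sum>n\<le>M. A n)"])
    show "0 \<le> C + (\<Sum>n\<le>M. A n)" using A C by (intro add_nonneg_nonneg sum_nonneg) auto
    fix x t :: real assume t: "0 < t" "t \<le> 1"
    have "\<bar>\<Sum>n\<le>M. fps_nth (G x) n * t ^ n\<bar> \<le> (\<Sum>n\<le>M. A n)"
    proof (intro order_trans[OF sum_abs] sum_mono)
      fix n assume "n \<in> {..M}"
      then have "\<bar>fps_nth (G x) n\<bar> * t ^ n \<le> A n * 1"
        using A t by (intro mult_mono power_le_one) auto
      then show "\<bar>fps_nth (G x) n * t ^ n\<bar> \<le> A n" using t by (simp add: abs_mult)
    qed
    moreover have "C * t ^ (M + 1) \<le> C * 1" using C t by (intro mult_left_mono power_le_one) auto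
    ultimately show "\<bar>g x t\<bar> \<le> C + (\<Sum>n\<le>M. A n)" using C(2)[OF t, of x] by linarith
  qed
qed

text \<open>The product of the two truncated expansions contains, apart from the truncated Cauchy product, only terms of
  degree above \<open>M\<close>.\<close>

lemma uniform_exp_mult:
  assumes "uniform_exp M g G" "uniform_exp M h H"
  shows "uniform_exp M (\<lambda>x t. g x t * h x t) (\<lambda>x. G x * H x)"
proof -
  obtain C where C: "C \<ge> 0" "\<And>x t. 0 < t \<Longrightarrow> t \<le> 1 \<Longrightarrow>
      \<bar>g x t - (\<Sum>n\<le>M. fps_nth (G x) n * t ^ n)\<bar> \<le> C * t ^ (M + 1)"
    using uniform_exp_remainder[OF assms(1)] by metis
  obtain D where D: "D \<ge> 0" "\<And>x t. 0 < t \<Longrightarrow> t \<le> 1 \<Longrightarrow>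
      \<bar>h x t - (\<Sum>n\<le>M. fps_nth (H x) n * t ^ n)\<bar> \<le> D * t ^ (M + 1)"
    using uniform_exp_remainder[OF assms(2)] by metis
  obtain A where A: "\<And>n. n \<le> M \<Longrightarrow> A n \<ge> 0" "\<And>n x. n \<le> M \<Longrightarrow> \<bar>fps_nth (G x) n\<bar> \<le> A n"
    using bounded_fun_obtain[of M "\<lambda>x. fps_nth (G x)"] uniform_exp_coeff[OF assms(1)] by metis
  obtain B where B: "\<And>n. n \<le> M \<Longrightarrow> B n \<ge> 0" "\<And>n x. n \<le> M \<Longrightarrow> \<bar>fps_nth (H x) n\<bar> \<le> B n"
    using bounded_fun_obtain[of M "\<lambda>x. fps_nth (H x)"] uniform_exp_coeff[OF assms(2)] by metis
  obtain Bg where Bg: "Bg \<ge> 0" "\<And>x t. 0 < t \<Longrightarrow> t \<le> 1 \<Longrightarrow> \<bar>g x t\<bar> \<le> Bg"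
    using uniform_exp_bounded[OF assms(1)] by metis
  have "uniform_exp M (\<lambda>x t. \<Sum>n\<le>M. fps_nth (H x) n * t ^ n) H"
    by (intro uniform_exp_poly uniform_exp_coeff[OF assms(2)])
  then obtain Bh where Bh: "Bh \<ge> 0" "\<And>x t. 0 < t \<Longrightarrow> t \<le> 1 \<Longrightarrow> \<bar>\<Sum>n\<le>M. fps_nth (H x) n * t ^ n\<bar> \<le> Bh"
    by (rule uniform_exp_bounded) metis
  define S where "S = {..M} \<times> {..M}"
  define T where "T = {(i, j). i + j \<le> M}"
  have TS: "T \<subseteq> S" "finite S" by (auto simp: S_def T_def)
  define E where "E = (\<Sum>(i, j)\<in>S - T. A i * B j)"
  show ?thesis
  proof (rule uniform_expI[of _ _ _ "Bg * D + C * Bh + E"])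
    fix n assume n: "n \<le> M"
    show "bounded_fun (\<lambda>x. fps_nth (G x * H x) n)"
      unfolding fps_mult_nth using n by (intro bounded_fun_sum bounded_fun_mult uniform_exp_coeff[OF assms(1)] uniform_exp_coeff[OF assms(2)]) auto
  next
    fix x t :: real assume t: "0 < t" "t \<le> 1"
    let ?P = "\<Sum>n\<le>M. fps_nth (G x) n * t ^ n" and ?Q = "\<Sum>n\<le>M. fps_nth (H x) n * t ^ n"
    let ?f = "\<lambda>i j. (fps_nth (G x) i * t ^ i) * (fps_nth (H x) j * t ^ j)"
    have "?P * ?Q = (\<Sum>(i, j)\<in>S. ?f i j)"
      by (simp add: sum_product S_def sum.cartesian_product)
    also have "\<dots> = (\<Sum>(i, j)\<in>S - T. ?f i j) + (\<Sum>(i, j)\<in>T. ?f i j)"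
      using TS by (intro sum.subset_diff)
    also have "(\<Sum>(i, j)\<in>T. ?f i j) = (\<Sum>n\<le>M. \<Sum>i\<le>n. ?f i (n - i))"
      unfolding T_def by (rule sum.triangle_reindex_eq)
    also have "\<dots> = (\<Sum>n\<le>M. fps_nth (G x * H x) n * t ^ n)"
    proof (intro sum.cong refl)
      fix n assume "n \<in> {..M}"
      have "?f i (n - i) = fps_nth (G x) i * fps_nth (H x) (n - i) * t ^ n" if "i \<le> n" for i
      proof -
        have "t ^ n = t ^ i * t ^ (n - i)" using that by (simp flip: power_add)
        then show ?thesis by simp
      qed
      then show "(\<Sum>i\<le>n. ?f i (n - i)) = fps_nth (G x * H x) n * t ^ n"
        unfolding fps_mult_nth sum_distrib_right by (intro sum.cong) auto
    qed
    finally have PQ: "?P * ?Q - (\<Sum>n\<le>M. fps_nth (G x * H x) n * t ^ n) = (\<Sum>(i, j)\<in>S - T. ?f i j)"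
      by simp
    have "\<bar>\<Sum>(i, j)\<in>S - T. ?f i j\<bar> \<le> (\<Sum>(i, j)\<in>S - T. A i * B j * t ^ (M + 1))"
    proof (rule order_trans[OF sum_abs], rule sum_mono, clarify)
      fix i j assume ij: "(i, j) \<in> S" "(i, j) \<notin> T"
      then have "i \<le> M" "j \<le> M" "M + 1 \<le> i + j" by (auto simp: S_def T_def)
      then have "\<bar>fps_nth (G x) i\<bar> * \<bar>fps_nth (H x) j\<bar> * t ^ (i + j) \<le> A i * B j * t ^ (M + 1)"
        using A B t by (intro mult_mono power_decreasing mult_nonneg_nonneg) auto
      then show "\<bar>?f i j\<bar> \<le> A i * B j * t ^ (M + 1)"
        using t by (simp add: abs_mult power_add mult_ac)
    qed
    also have "\<dots> = E * t ^ (M + 1)"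
      unfolding E_def sum_distrib_right by (intro sum.cong) auto
    finally have E: "\<bar>?P * ?Q - (\<Sum>n\<le>M. fps_nth (G x * H x) n * t ^ n)\<bar> \<le> E * t ^ (M + 1)"
      unfolding PQ .
    have "\<bar>g x t * (h x t - ?Q)\<bar> \<le> Bg * (D * t ^ (M + 1))"
      unfolding abs_mult using Bg(1) Bg(2)[OF t] D(2)[OF t] by (intro mult_mono) auto
    moreover have "\<bar>(g x t - ?P) * ?Q\<bar> \<le> (C * t ^ (M + 1)) * Bh"
      unfolding abs_mult using Bh(2)[OF t] C(1) C(2)[OF t] t by (intro mult_mono) auto
    moreover have "g x t * h x t - (\<Sum>n\<le>M. fps_nth (G x * H x) n * t ^ n)
        = g x t * (h x t - ?Q) + (g x t - ?P) * ?Q + (?P * ?Q - (\<Sum>n\<le>M. fps_nth (G x * H x) n * t ^ n))"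
      by (simp add: algebra_simps)
    moreover have "(Bg * D + C * Bh + E) * t ^ (M + 1)
        = Bg * (D * t ^ (M + 1)) + (C * t ^ (M + 1)) * Bh + E * t ^ (M + 1)"
      by (simp only: algebra_simps)
    ultimately show "\<bar>g x t * h x t - (\<Sum>n\<le>M. fps_nth (G x * H x) n * t ^ n)\<bar> \<le> (Bg * D + C * Bh + E) * t ^ (M + 1)"
      using E by linarith
  qed
qed

lemma uniform_exp_sum:
  assumes "\<And>i. i \<in> I \<Longrightarrow> uniform_exp M (g i) (G i)"
  shows "uniform_exp M (\<lambda>x t. \<Sum>i\<in>I. g i x t) (\<lambda>x. \<Sum>i\<in>I. G i x)"
  using assms
proof (induction I rule: infinite_finite_induct)
  case (insert i I)
  then show ?case by (simp add: uniform_exp_add)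
qed (use uniform_exp_const[OF bounded_fun_const, of _ 0] in simp_all)

lemma uniform_exp_minus:
  assumes "uniform_exp M g G" shows "uniform_exp M (\<lambda>x t. - g x t) (\<lambda>x. - G x)"
proof -
  have "fps_const (- 1) * F = - F" for F :: "real fps" by (simp flip: fps_const_neg)
  then show ?thesis
    using uniform_exp_mult[OF uniform_exp_const[OF bounded_fun_const, of M "- 1"] assms] by simp
qed

lemma uniform_exp_power:
  assumes "uniform_exp M g G" shows "uniform_exp M (\<lambda>x t. g x t ^ k) (\<lambda>x. G x ^ k)"
  by (induction k) (use uniform_exp_const[OF bounded_fun_const, of M 1] in \<open>simp_all add: uniform_exp_mult assms\<close>)

text \<open>Formal composition with the Taylor series is the uniform expansion of actual composition: Taylor's theorem
  of order \<open>M\<close> applies with a remainder bounded uniformly in \<open>x\<close>, and the increment is \<open>O(t)\<close> because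
  its formal series has no constant term.\<close>

lemma uniform_exp_compose:
  assumes f: "smooth_bdd f" and h: "uniform_exp M h H" and H0: "\<And>x. fps_nth (H x) 0 = 0"
  shows "uniform_exp M (\<lambda>x t. f (x + h x t)) (\<lambda>x. taylor_fps f x oo H x)"
proof -
  obtain D where D: "D 0 = f" "\<And>n x. (D n has_real_derivative D (Suc n) x) (at x)"
    and "\<And>n. \<exists>C. \<forall>x. \<bar>D n x\<bar> \<le> C"
    using f unfolding smooth_bdd_def by metis
  then have Db: "bounded_fun (D n)" for n using bounded_funI by metis
  have Dn: "(deriv ^^ n) f = D n" for n
  proof (induction n)
    case (Suc n)
    have "deriv (D n) = D (Suc n)" using D(2) DERIV_imp_deriv by blast
    then show ?case using Suc by simp
  qed (simp add: D)
  have tf: "fps_nth (taylor_fps f x) n = D n x / fact n" for x n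
    by (simp add: taylor_fps_def Dn)
  obtain B where B: "B \<ge> 0" "\<And>x t. 0 < t \<Longrightarrow> t \<le> 1 \<Longrightarrow> \<bar>h x t\<bar> \<le> B * t"
  proof -
    obtain C where C: "C \<ge> 0" "\<And>x t. 0 < t \<Longrightarrow> t \<le> 1 \<Longrightarrow>
        \<bar>h x t - (\<Sum>n\<le>M. fps_nth (H x) n * t ^ n)\<bar> \<le> C * t ^ (M + 1)"
      using uniform_exp_remainder[OF h] by metis
    obtain A where A: "\<And>n. n \<le> M \<Longrightarrow> A n \<ge> 0" "\<And>n x. n \<le> M \<Longrightarrow> \<bar>fps_nth (H x) n\<bar> \<le> A n"
      using bounded_fun_obtain[of M "\<lambda>x. fps_nth (H x)"] uniform_exp_coeff[OF h] by metis
    show ?thesis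
    proof (rule that[of "C + (\<Sum>n\<le>M. A n)"])
      show "0 \<le> C + (\<Sum>n\<le>M. A n)" using A C by (intro add_nonneg_nonneg sum_nonneg) auto
      fix x t :: real assume t: "0 < t" "t \<le> 1"
      have "\<bar>\<Sum>n\<le>M. fps_nth (H x) n * t ^ n\<bar> \<le> (\<Sum>n\<le>M. A n * t)"
      proof (intro order_trans[OF sum_abs] sum_mono)
        fix n assume n: "n \<in> {..M}"
        show "\<bar>fps_nth (H x) n * t ^ n\<bar> \<le> A n * t"
        proof (cases "n = 0")
          case True
          then show ?thesis using H0 A t by simp
        next
          case False
          have "t ^ n \<le> t ^ 1" using False t by (intro power_decreasing) auto
          then have "\<bar>fps_nth (H x) n\<bar> * t ^ n \<le> A n * t"
            using A n t by (intro mult_mono) auto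
          then show ?thesis using t by (simp add: abs_mult)
        qed
      qed
      moreover have "C * t ^ (M + 1) \<le> C * t"
        using C t power_decreasing[of 1 "M + 1" t] by (intro mult_left_mono) auto
      ultimately show "\<bar>h x t\<bar> \<le> (C + (\<Sum>n\<le>M. A n)) * t"
        using C(2)[OF t, of x] by (simp add: distrib_right sum_distrib_right)
    qed
  qed
  have "uniform_exp M (\<lambda>x t. \<Sum>i\<le>M. D i x / fact i * h x t ^ i) (\<lambda>x. \<Sum>i\<le>M. fps_const (D i x / fact i) * H x ^ i)"
  proof (intro uniform_exp_sum uniform_exp_mult uniform_exp_const uniform_exp_power h)
    fix i show "bounded_fun (\<lambda>x. D i x / fact i)"
      using bounded_fun_mult[OF Db[of i] bounded_fun_const[of "1 / fact i"]] by simp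
  qed
  moreover have "fps_nth (taylor_fps f x oo H x) n = fps_nth (\<Sum>i\<le>M. fps_const (D i x / fact i) * H x ^ i) n"
    if "n \<le> M" for x n
  proof -
    have "(\<Sum>i\<in>{0..n}. D i x / fact i * fps_nth (H x ^ i) n) = (\<Sum>i\<le>M. D i x / fact i * fps_nth (H x ^ i) n)"
      using that H0[of x] by (intro sum.mono_neutral_left) (auto simp: startsby_zero_power_prefix)
    then show ?thesis by (simp add: fps_compose_nth tf fps_sum_nth)
  qed
  ultimately have "uniform_exp M (\<lambda>x t. \<Sum>i\<le>M. D i x / fact i * h x t ^ i) (\<lambda>x. taylor_fps f x oo H x)"
    by (rule uniform_exp_cong)
  moreover obtain C where C: "C \<ge> 0" "\<And>x. \<bar>D (M + 1) x\<bar> \<le> C"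
    using Db[of "M + 1"] unfolding bounded_fun_def by blast
  have "\<bar>f (x + h x t) - (\<Sum>i\<le>M. D i x / fact i * h x t ^ i)\<bar> \<le> (C * B ^ (M + 1)) * t ^ (M + 1)"
    if t: "0 < t" "t \<le> 1" for x t
  proof -
    have "\<forall>m y. ((\<lambda>y. D m (x + y)) has_real_derivative D (Suc m) (x + y)) (at y)"
    proof (intro allI)
      fix m y
      have "((\<lambda>y. D m (y + x)) has_real_derivative D (Suc m) (y + x)) (at y)"
        using D(2)[of m "y + x"] unfolding DERIV_shift .
      then show "((\<lambda>y. D m (x + y)) has_real_derivative D (Suc m) (x + y)) (at y)"
        by (simp add: add.commute)
    qed
    from Maclaurin_all_le[of "\<lambda>m y. D m (x + y)" "\<lambda>y. f (x + y)", OF _ this, of "h x t" "M + 1"]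
    obtain y where "f (x + h x t) = (\<Sum>i<M + 1. D i x / fact i * h x t ^ i)
        + D (M + 1) (x + y) / fact (M + 1) * h x t ^ (M + 1)"
      using D(1) by auto
    then have "\<bar>f (x + h x t) - (\<Sum>i\<le>M. D i x / fact i * h x t ^ i)\<bar>
        = \<bar>D (M + 1) (x + y)\<bar> / fact (M + 1) * \<bar>h x t\<bar> ^ (M + 1)"
      by (simp add: lessThan_Suc_atMost abs_mult power_abs)
    also have "\<dots> \<le> C * (B * t) ^ (M + 1)"
    proof (intro mult_mono power_mono B(2)[OF t])
      have "\<bar>D (M + 1) (x + y)\<bar> / fact (M + 1) \<le> \<bar>D (M + 1) (x + y)\<bar> / 1"
        by (intro divide_left_mono fact_ge_1) auto
      then show "\<bar>D (M + 1) (x + y)\<bar> / fact (M + 1) \<le> C" using C(2)[of "x + y"] by linarith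
    qed (use C in auto)
    finally show ?thesis by (simp only: power_mult_distrib mult.assoc)
  qed
  ultimately show ?thesis by (rule uniform_exp_perturb)
qed

definition Qfps :: "real \<Rightarrow> real fps" where
  "Qfps x = (THE Q. fps_nth Q 0 = 0 \<and> fps_nth Q 1 = 0 \<and> formal_identity x Q)"

lemma q_coeff_eq: "q_coeff k x = fps_nth (Qfps x) k"
  by (simp add: q_coeff_def Qfps_def)

lemma Qfps_0: "fps_nth (Qfps x) 0 = 0"
  and Qfps_1: "fps_nth (Qfps x) 1 = 0"
  and Qfps_Suc: "fps_nth (Qfps x) (Suc n) = q_step x n (Qfps x)"
  using theI'[OF q_coeff_well_defined[of x]] formal_identity_iff[of "Qfps x" x]
  unfolding Qfps_def[symmetric] by auto

text \<open>By induction along the recursion for the coefficients. The boundedness of the coefficients of a composition comes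
  from \<open>uniform_exp_compose\<close>, applied to the polynomial formed from the coefficients already treated.\<close>

lemma bounded_fun_Qfps: "bounded_fun (\<lambda>x. fps_nth (Qfps x) n)"
proof (induction n rule: less_induct)
  case (less n)
  show ?case
  proof (cases n)
    case 0
    then show ?thesis by (simp add: Qfps_0 bounded_fun_const)
  next
    case (Suc m)
    have comp: "bounded_fun (\<lambda>x. fps_nth (taylor_fps f x oo Qfps x) i)" if "smooth_bdd f" "i \<le> m" for f i
      using uniform_exp_coeff[OF uniform_exp_compose[OF that(1) uniform_exp_poly[of m Qfps]] that(2)] less Suc Qfps_0 by simp
    have "bounded_fun (\<lambda>x. if m = 0 then arctan x else 0)"
      using abs_arctan_le_2 by (cases "m = 0") (auto intro: bounded_funI bounded_fun_const)
    then have "bounded_fun (\<lambda>x. q_step x m (Qfps x))"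
      unfolding q_step_def
      by (intro bounded_fun_diff bounded_fun_sum comp smooth_bdd_arctan smooth_bdd_L_coeff) auto
    then show ?thesis using Suc by (simp add: Qfps_Suc)
  qed
qed

text \<open>After multiplication by \<open>t = 1 / a\<close>, the two sides of the defining identity of \<open>q\<^sub>k\<close> have uniform expansions in \<open>t\<close>
  whose coefficients agree up to degree \<open>N\<close>. The error \<open>O(t^(N+1))\<close> loses one order when the factor \<open>t\<close> is removed.\<close>

lemma trunc_phase_at_approximation:
  assumes "N \<ge> 1"
  shows "\<exists>C\<ge>0. \<forall>x. \<forall>a\<ge>1. \<bar>trunc_phase N a (x + (\<Sum>k=2..N. q_coeff k x / a ^ k)) - (a * x - arctan x)\<bar> \<le> C * (1 / a) ^ N"
proof -
  define h where "h = (\<lambda>x t. \<Sum>n\<le>N. fps_nth (Qfps x) n * t ^ n)"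
  have h: "uniform_exp N h Qfps" unfolding h_def by (intro uniform_exp_poly bounded_fun_Qfps)
  \<comment> \<open>\<open>W\<close> is \<open>t\<close> times the defect of the phase equation at \<open>x + h x t\<close>, and \<open>V\<close> is its formal counterpart.\<close>
  define W where "W = (\<lambda>x t. h x t + - (t ^ 1 * (arctan (x + h x t) + - arctan x))
    + (\<Sum>s<N. t ^ (s + 2) * L_coeff (Suc s) (x + h x t)))"
  define V where "V = (\<lambda>x. Qfps x + - (fps_X ^ 1 * ((taylor_fps arctan x oo Qfps x) + - fps_const (arctan x)))
    + (\<Sum>s<N. fps_X ^ (s + 2) * (taylor_fps (L_coeff (Suc s)) x oo Qfps x)))"
  have "bounded_fun arctan" using abs_arctan_le_2 by (rule bounded_funI)
  then have W: "uniform_exp N W V"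
    unfolding W_def V_def
    by (intro uniform_exp_add uniform_exp_minus uniform_exp_mult uniform_exp_X_power uniform_exp_sum uniform_exp_const uniform_exp_compose h
        smooth_bdd_arctan smooth_bdd_L_coeff Qfps_0) auto
  have V: "fps_nth (V x) n = 0" if "n \<le> N" for x n
  proof (cases n)
    case 0
    then show ?thesis by (simp add: V_def Qfps_0 fps_sum_nth fps_X_power_mult_nth del: power_Suc)
  next
    case (Suc m)
    let ?c = "\<lambda>s k. fps_nth (taylor_fps (L_coeff (Suc s)) x oo Qfps x) k"
    have "(\<Sum>s<N. if Suc m < s + 2 then 0 else ?c s (Suc m - (s + 2))) = (\<Sum>s<m. ?c s (m - Suc s))"
      using that Suc by (intro sum.mono_neutral_cong_right) auto
    then have "fps_nth (\<Sum>s<N. fps_X ^ (s + 2) * (taylor_fps (L_coeff (Suc s)) x oo Qfps x)) (Suc m)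
        = (\<Sum>s<m. ?c s (m - Suc s))"
      by (simp only: fps_sum_nth fps_X_power_mult_nth)
    then show ?thesis
      unfolding V_def Suc by (simp add: Qfps_Suc q_step_def)
  qed
  obtain C where C: "C \<ge> 0" "\<And>x t. 0 < t \<Longrightarrow> t \<le> 1 \<Longrightarrow> \<bar>W x t\<bar> \<le> C * t ^ (N + 1)"
    using uniform_exp_remainder[OF W] V by auto
  show ?thesis
  proof (intro exI[of _ C] conjI C allI impI)
    fix x a :: real assume a: "a \<ge> 1"
    define t where "t = 1 / a"
    have t: "0 < t" "t \<le> 1" "a * t = 1" using a by (auto simp: t_def)
    have hx: "h x t = (\<Sum>k=2..N. q_coeff k x / a ^ k)"
    proof -
      have "h x t = (\<Sum>n\<in>{2..N}. fps_nth (Qfps x) n * t ^ n)"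
        unfolding h_def
      proof (rule sum.mono_neutral_right)
        show "\<forall>i\<in>{..N} - {2..N}. fps_nth (Qfps x) i * t ^ i = 0"
        proof
          fix i assume "i \<in> {..N} - {2..N}"
          then have "i = 0 \<or> i = 1" by auto
          then show "fps_nth (Qfps x) i * t ^ i = 0" using Qfps_0 Qfps_1 by auto
        qed
      qed auto
      then show ?thesis by (simp add: q_coeff_eq t_def power_divide)
    qed
    let ?y = "x + h x t"
    have "a * W x t = a * h x t - (a * t) * (arctan ?y - arctan x) + (\<Sum>s<N. (a * t) * t ^ (Suc s) * L_coeff (Suc s) ?y)"
      by (simp add: W_def algebra_simps sum_distrib_left)
    also have "\<dots> = a * h x t - (arctan ?y - arctan x) + (\<Sum>s<N. L_coeff (Suc s) ?y / a ^ Suc s)"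
      by (simp only: t(3)) (simp add: t_def power_divide)
    also have "(\<Sum>s<N. L_coeff (Suc s) ?y / a ^ Suc s) = (\<Sum>s=1..N. L_coeff s ?y / a ^ s)"
      by (simp add: sum.atLeast1_atMost_eq del: power_Suc)
    finally have "trunc_phase N a ?y - (a * x - arctan x) = a * W x t"
      by (simp add: trunc_phase_def algebra_simps)
    then have "\<bar>trunc_phase N a ?y - (a * x - arctan x)\<bar> = a * \<bar>W x t\<bar>"
      using a by (simp add: abs_mult)
    also have "\<dots> \<le> a * (C * t ^ (N + 1))" using a C(2)[OF t(1,2)] by (intro mult_left_mono) auto
    also have "\<dots> = (a * t) * C * t ^ N" by simp
    finally show "\<bar>trunc_phase N a (x + (\<Sum>k=2..N. q_coeff k x / a ^ k)) - (a * x - arctan x)\<bar> \<le> C * (1 / a) ^ N"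
      by (simp only: t(3) hx mult_1) (simp only: t_def)
  qed
qed

section \<open>The asymptotic expansion of the zeros\<close>

theorem mainTheorem5:
  fixes N :: nat
  assumes "N \<ge> 1"
  shows "\<exists>C. \<forall>\<^sub>F a in at_top. \<forall>m\<ge>1.
           \<bar>Si_zero m a - Si_zero0 m a - (\<Sum>k=2..N. q_coeff k (Si_zero0 m a) / a ^ k)\<bar>
             \<le> C / a ^ (N + 1)"
proof -
  obtain C1 a1 where C1: "C1 \<ge> 0" and a1: "a1 > 1" and phase: "\<forall>a\<ge>a1. continuous_on {0..} (phase a)
      \<and> (\<forall>\<theta>>0. \<exists>d\<ge>a / 2. (phase a has_real_derivative d) (at \<theta>))
      \<and> (\<forall>\<theta>>0. Si a (a * \<theta>) = 0 \<longleftrightarrow> sin (phase a \<theta>) = 0)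
      \<and> (\<forall>\<theta>>0. \<bar>phase a \<theta> - trunc_phase N a \<theta>\<bar> \<le> C1 * (1 / a) ^ (N + 1))"
    using phase_approx[OF assms] by (elim exE conjE) (rule that)
  obtain a2 where a2: "\<And>a \<theta>. a \<ge> a2 \<Longrightarrow> \<exists>D\<ge>3 / 4 * a. (trunc_phase N a has_real_derivative D) (at \<theta>)"
    using trunc_phase_derivative_lower_bound by blast
  obtain C2 where C2: "C2 \<ge> 0" "\<And>x a. a \<ge> 1 \<Longrightarrow>
      \<bar>trunc_phase N a (x + (\<Sum>k=2..N. q_coeff k x / a ^ k)) - (a * x - arctan x)\<bar> \<le> C2 * (1 / a) ^ N"
    using trunc_phase_at_approximation[OF assms] by blast
  have "\<bar>Si_zero m a - Si_zero0 m a - (\<Sum>k=2..N. q_coeff k (Si_zero0 m a) / a ^ k)\<bar>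
      \<le> 4 / 3 * (C1 + C2) / a ^ (N + 1)" if "a \<ge> max a1 a2" "m \<ge> 1" for a m
  proof -
    have a: "a \<ge> a1" "a \<ge> a2" "a > 1" using that a1 by auto
    define u v where "u = Si_zero m a"
      and "v = Si_zero0 m a + (\<Sum>k=2..N. q_coeff k (Si_zero0 m a) / a ^ k)"
    have "u > 0" "phase a u = real m * pi"
      unfolding u_def
      using Si_zero_properties[of a m] a that(2) phase by auto
    then have "\<bar>real m * pi - trunc_phase N a u\<bar> \<le> C1 * (1 / a) ^ (N + 1)"
      using phase a(1) by metis
    also have "\<dots> \<le> C1 * (1 / a) ^ N"
      using a C1 by (intro mult_left_mono power_decreasing) auto
    finally have u: "\<bar>real m * pi - trunc_phase N a u\<bar> \<le> C1 * (1 / a) ^ N" .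
    have v: "\<bar>trunc_phase N a v - real m * pi\<bar> \<le> C2 * (1 / a) ^ N"
      using C2(2)[of a "Si_zero0 m a"] Si_zero0_eq[OF a(3) that(2)] a by (simp add: v_def)
    have incr: "3 / 4 * a * (y - x) \<le> trunc_phase N a y - trunc_phase N a x" if "x < y" for x y
      using that a2[OF a(2)] DERIV_isCont
      by (intro mean_value_lower_bound continuous_at_imp_continuous_on ballI) blast+
    \<comment> \<open>The steep slope turns an error in the phase into an error in \<open>\<theta>\<close> that is smaller by a factor \<open>1 / a\<close>.\<close>
    have "3 / 4 * a * \<bar>u - v\<bar> \<le> \<bar>trunc_phase N a u - trunc_phase N a v\<bar>"
      using incr[of u v] incr[of v u] by (cases u v rule: linorder_cases) (auto simp: abs_if)
    also have "\<dots> \<le> (C1 + C2) * (1 / a) ^ N" using u v by (simp only: distrib_right)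
    finally have "\<bar>u - v\<bar> \<le> 4 / 3 * (C1 + C2) / a ^ (N + 1)"
      using a by (simp add: field_simps)
    then show ?thesis by (simp add: u_def v_def diff_diff_eq)
  qed
  then show ?thesis
    unfolding eventually_at_top_linorder by blast
qed

end
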